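(* Let $d\in\mathbb{N}$, $d\ge 1$, and let $F\subset\mathbb{R}^d$ be a nonempty compact set. Then all elements of the gallery $\mathcal{G}_F$ have the same Hausdorff dimension if and only if \[ \dim_{\mathrm{L}} F=\dim_{\mathrm{A}} F . \]
   Context: Dimensions. For a bounded set $A\subset\mathbb{R}^d$ and $r>0$, $N_r(A)$ is the smallest number of cubes of side length $r$ needed to cover $A$. $B(x,R)$ is the closed ball of centre $x$ and radius $R$. The lower dimension is \[ \dim_{\mathrm{L}} F=\sup\Big\{s\ge 0: \exists C>0\ \forall\, 0<R<1\ \forall\, r\in(0,R)\ \forall x\in F:\ N_r(B(x,R)\cap F)\ge C\big(\tfrac{R}{r}\big)^s\Big\}, \] and the Assouad dimension is \[ \dim_{\mathrm{A}} F=\inf\Big\{s\ge 0: \exists C>0\ \forall R>0\ \forall\, r\in(0,R)\ \forall x\in F:\ N_r(B(x,R)\cap F)\le C\big(\tfrac{R}{r}\big)^s\Big\}. \] Microsets and galleries. Let $X=[0,1]^d$ and let $\mathcal{K}(X)$ be the space of nonempty compact subsets of $X$ with the Hausdorff metric. A set $D\in\mathcal{K}(X)$ is a miniset of a compact set $F\subset\mathbb{R}^d$ if $D=(\lambda F+t)\cap X$ for some $\lambda\ge 1$ and $t\in\mathbb{R}^d$. A set $E\in\mathcal{K}(X)$ is a microset of $F$ if it is a limit, in the Hausdorff metric, of a sequence of minisets of $F$ (the scaling coefficients $\lambda$ are not required to be unbounded along the sequence). The gallery $\mathcal{G}_F$ is the collection of all microsets of $F$ which intersect the interior $(0,1)^d$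 of $X$. *)

theory Defs
  imports "HOL-Analysis.Analysis"
begin

text \<open>
  Euclidean space of dimension d is \<open>real ^ 'n\<close> with \<open>CARD('n) = d\<close>. In this type \<open>1\<close> is the
  all-ones vector, so \<open>cbox 0 1\<close> is the closed unit cube and \<open>box 0 1\<close> is its interior.
\<close>

section \<open>Covering numbers, lower dimension and Assouad dimension\<close>

text \<open>
  Cubes are closed and axis-parallel. For \<open>r > 0\<close> and bounded \<open>A\<close> the minimum is attained
  (see \<open>covering_number_attained\<close> below); nothing is intended for other arguments.
\<close>

definition covering_number :: "real \<Rightarrow> (real ^ 'n) set \<Rightarrow> nat" where
  "covering_number r A =
     (LEAST k. \<exists>P. finite P \<and> card P = k \<and> A \<subseteq> (\<Union>a\<in>P. cbox a (a + r *\<^sub>R 1)))"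

text \<open>
  The supremum and infimum are taken in the extended reals only to have them defined for every set.
\<close>

definition lower_dim :: "(real ^ 'n) set \<Rightarrow> ereal" where
  "lower_dim F = Sup {ereal s | s. 0 \<le> s \<and>
     (\<exists>C>0. \<forall>R r. \<forall>x\<in>F. 0 < R \<and> R < 1 \<and> 0 < r \<and> r < R \<longrightarrow>
        real (covering_number r (cball x R \<inter> F)) \<ge> C * (R / r) powr s)}"

definition assouad_dim :: "(real ^ 'n) set \<Rightarrow> ereal" where
  "assouad_dim F = Inf {ereal s | s. 0 \<le> s \<and>
     (\<exists>C>0. \<forall>R r. \<forall>x\<in>F. 0 < R \<and> 0 < r \<and> r < R \<longrightarrow>
        real (covering_number r (cball x R \<inter> F)) \<le> C * (R / r) powr s)}"

section \<open>Hausdorff measure and Hausdorff dimension\<close>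

text \<open>
  The s-th power of the diameter, with the usual convention for \<open>s = 0\<close>: every nonempty set,
  in particular a singleton, contributes 1. (In the library \<open>0 powr 0 = 0\<close>.)
\<close>

definition diam_power :: "real \<Rightarrow> 'a::metric_space set \<Rightarrow> ennreal" where
  "diam_power s U =
     (if U = {} then 0 else if s = 0 then 1 else ennreal (diameter U powr s))"

text \<open>
  Boundedness of the covering sets has to be required separately, because \<open>diameter\<close> has no
  meaningful value on unbounded sets.
\<close>

definition hausdorff_premeasure :: "real \<Rightarrow> real \<Rightarrow> 'a::metric_space set \<Rightarrow> ennreal" where
  "hausdorff_premeasure s \<delta> A =
     Inf {(\<Sum>i. diam_power s (U i)) | U :: nat \<Rightarrow> 'a set.
            A \<subseteq> (\<Union>i. U i) \<and> (\<forall>i. bounded (U i) \<and> diameter (U i) \<le> \<delta>)}"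

definition hausdorff_measure :: "real \<Rightarrow> 'a::metric_space set \<Rightarrow> ennreal" where
  "hausdorff_measure s A = (SUP \<delta>\<in>{0<..}. hausdorff_premeasure s \<delta> A)"

definition hausdorff_dim :: "'a::metric_space set \<Rightarrow> ereal" where
  "hausdorff_dim A = Inf {ereal s | s. 0 \<le> s \<and> hausdorff_measure s A = 0}"

section \<open>Minisets, microsets and the gallery\<close>

text \<open>This is the Hausdorff metric on nonempty compact sets, the only place where it is used.\<close>

definition hausdorff_distance :: "'a::metric_space set \<Rightarrow> 'a set \<Rightarrow> real" where
  "hausdorff_distance A B = max (SUP a\<in>A. infdist a B) (SUP b\<in>B. infdist b A)"

definition unit_cube_compacts :: "(real ^ 'n) set set" where
  "unit_cube_compacts = {D. D \<noteq> {} \<and> compact D \<and> D \<subseteq> cbox 0 1}"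

definition miniset :: "(real ^ 'n) set \<Rightarrow> (real ^ 'n) set \<Rightarrow> bool" where
  "miniset F D \<longleftrightarrow> D \<in> unit_cube_compacts \<and>
     (\<exists>c t. 1 \<le> c \<and> D = (\<lambda>x. c *\<^sub>R x + t) ` F \<inter> cbox 0 1)"

definition microset :: "(real ^ 'n) set \<Rightarrow> (real ^ 'n) set \<Rightarrow> bool" where
  "microset F E \<longleftrightarrow> E \<in> unit_cube_compacts \<and>
     (\<exists>D. (\<forall>k::nat. miniset F (D k)) \<and> (\<lambda>k. hausdorff_distance (D k) E) \<longlonglongrightarrow> 0)"

definition gallery :: "(real ^ 'n) set \<Rightarrow> (real ^ 'n) set set" where
  "gallery F = {E. microset F E \<and> E \<inter> box 0 1 \<noteq> {}}"

section \<open>The covering number is attained\<close>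

lemma covering_number_attained:
  fixes A :: "(real ^ 'n) set"
  assumes "bounded A" "r > 0"
  obtains P where "finite P" "card P = covering_number r A"
    "A \<subseteq> (\<Union>a\<in>P. cbox a (a + r *\<^sub>R 1))"
proof -
  let ?h = "(r / 2) *\<^sub>R (1 :: real ^ 'n)"
  have "compact (closure A)"
    using assms(1) by (simp add: compact_closure)
  moreover have "closure A \<subseteq> \<Union> ((\<lambda>x. box (x - ?h) (x + ?h)) ` closure A)"
    using assms(2) by (auto simp: mem_box_cart)
  ultimately obtain T where T: "finite T" "closure A \<subseteq> (\<Union>x\<in>T. box (x - ?h) (x + ?h))"
    by (metis (no_types, lifting) compactE_image open_box)
  have "box (x - ?h) (x + ?h) \<subseteq> cbox (x - ?h) ((x - ?h) + r *\<^sub>R 1)" for x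
  proof
    fix y assume "y \<in> box (x - ?h) (x + ?h)"
    hence y: "x $ i - r / 2 < y $ i" "y $ i < x $ i + r / 2" for i
      by (auto simp: mem_box_cart)
    have "x $ i - r / 2 \<le> y $ i \<and> y $ i \<le> x $ i - r / 2 + r" for i
      using y[of i] by linarith
    thus "y \<in> cbox (x - ?h) ((x - ?h) + r *\<^sub>R 1)"
      by (simp add: mem_box_cart)
  qed
  hence "A \<subseteq> (\<Union>a\<in>(\<lambda>x. x - ?h) ` T. cbox a (a + r *\<^sub>R 1))"
    using T(2) closure_subset[of A] by fastforce
  hence "\<exists>k P. finite P \<and> card P = k \<and> A \<subseteq> (\<Union>a\<in>P. cbox a (a + r *\<^sub>R 1))"
    using T(1) by blast
  from LeastI_ex[OF this] show ?thesis
    using that unfolding covering_number_def by blast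
qed

end

theory Submission
  imports Defs "HOL-Complex_Analysis.Great_Picard"
begin

text \<open>
  The proof counts separated points. The covering number of a set at scale \<open>r\<close> is comparable with
  the largest number of its points at mutual distance about \<open>r\<close>. Similarities rescale separated
  sets, and a small perturbation in the Hausdorff metric costs only a little of the separation.
  Hence uniform statements about the balls of \<open>F\<close> pass to all microsets, and balls that are
  atypical on longer and longer ranges of scales have atypical microsets as limits of their zooms.

  Every gallery element \<open>E\<close> satisfies \<open>lower_dim F \<le> hausdorff_dim E \<le> assouad_dim F\<close>. The
  Assouad bound on separated points holds uniformly for all minisets, so it holds for \<open>E\<close> and
  bounds its box counts (\<open>hausdorff_dim_microset_le_assouad_dim\<close>). The lower dimension makes
  \<open>E\<close> branch at every small scale near an interior point of the cube, and such branching
  bounds the cost of covers from below (\<open>lower_dim_le_hausdorff_dim_gallery\<close>). So equality of the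
  two dimensions of \<open>F\<close> forces a single Hausdorff dimension in the gallery.

  Conversely, let \<open>lower_dim F < s < t < assouad_dim F\<close>. Suppose that each small ball of \<open>F\<close> had, at
  some dyadic scale within its first \<open>L\<close> levels, at least as many separated points as a set of
  dimension \<open>s\<close>. Iterating this would give \<open>s \<le> lower_dim F\<close> (\<open>lower_dim_ge_if_branching\<close>).
  So for each \<open>L\<close> some ball is sparse at all of its first \<open>L\<close> levels; a limit of zooms into these
  balls is a gallery element of dimension at most \<open>s\<close> (\<open>ex_gallery_hausdorff_dim_le\<close>). Dually, if
  each small ball had a cover by balls from its first \<open>L\<close> levels with relative \<open>t\<close>-cost at most
  \<open>1\<close>, iterating would give \<open>assouad_dim F \<le> t\<close> (\<open>assouad_dim_le_if_efficient_covers\<close>). So some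
  balls have only costly covers, and a limit of zooms into them is a gallery element of dimension
  at least \<open>t\<close> (\<open>ex_gallery_hausdorff_dim_ge\<close>). The limits exist because the nonempty compact subsets
  of the cube form a compact space in the Hausdorff metric (\<open>hausdorff_compactness\<close>).
\<close>

section \<open>Separated sets and covering numbers\<close>

definition separated_by :: "real \<Rightarrow> 'a::metric_space set \<Rightarrow> bool" where
  "separated_by \<delta> Y \<longleftrightarrow> pairwise (\<lambda>x y. \<delta> < dist x y) Y"

lemma separated_byD:
  "separated_by \<delta> Y \<Longrightarrow> x \<in> Y \<Longrightarrow> y \<in> Y \<Longrightarrow> x \<noteq> y \<Longrightarrow> \<delta> < dist x y"
  by (auto simp: separated_by_def pairwise_def)

lemma separated_byI:
  "(\<And>x y. x \<in> Y \<Longrightarrow> y \<in> Y \<Longrightarrow> x \<noteq> y \<Longrightarrow> \<delta> < dist x y) \<Longrightarrow> separated_by \<delta> Y"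
  by (auto simp: separated_by_def pairwise_def)

lemma separated_by_mono: "separated_by \<delta> Y \<Longrightarrow> \<delta>' \<le> \<delta> \<Longrightarrow> separated_by \<delta>' Y"
  by (fastforce simp: separated_by_def pairwise_def)

text \<open>
  Pigeonhole: a piece of diameter at most \<open>\<delta>\<close> holds at most one point of a \<open>\<delta>\<close>-separated set.
\<close>

lemma separated_card_le:
  assumes "finite P" and "Y \<subseteq> (\<Union>p\<in>P. S p)" and "separated_by \<delta> Y"
    and small: "\<And>p x y. p \<in> P \<Longrightarrow> x \<in> S p \<Longrightarrow> y \<in> S p \<Longrightarrow> dist x y \<le> \<delta>"
  shows "card Y \<le> card P"
proof -
  obtain f where f: "\<And>y. y \<in> Y \<Longrightarrow> f y \<in> P \<and> y \<in> S (f y)"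
    using assms(2) by (metis UN_E subsetD)
  have "inj_on f Y"
    using f small separated_byD[OF assms(3)] by (metis inj_onI not_less)
  moreover have "f ` Y \<subseteq> P"
    using f by blast
  ultimately show ?thesis
    using assms(1) by (rule card_inj_on_le)
qed

text \<open>
  A \<open>\<delta>\<close>-separated subset of largest cardinality is a net, since a point farther than \<open>\<delta>\<close> from it
  could be added. Total boundedness and the pigeonhole bound make the cardinalities bounded.
\<close>

lemma ex_separated_net:
  fixes A :: "'a::heine_borel set"
  assumes "bounded A" and "0 < \<delta>"
  obtains Y where "finite Y" "Y \<subseteq> A" "separated_by \<delta> Y" "A \<subseteq> (\<Union>y\<in>Y. cball y \<delta>)"
proof -
  have "compact (closure A)"
    using assms(1) by (simp add: compact_closure)
  then obtain T where T: "finite T" "closure A \<subseteq> (\<Union>t\<in>T. ball t (\<delta> / 2))"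
    using assms(2) by (metis compact_eq_totally_bounded half_gt_zero)
  have bound: "card Y \<le> card T" if "Y \<subseteq> A" "separated_by \<delta> Y" for Y
  proof (rule separated_card_le[OF T(1) _ that(2)])
    show "Y \<subseteq> (\<Union>t\<in>T. ball t (\<delta> / 2))"
      using that(1) T(2) closure_subset by blast
    show "dist x y \<le> \<delta>" if "x \<in> ball p (\<delta> / 2)" "y \<in> ball p (\<delta> / 2)" for p x y
      using that dist_triangle2[of x y p] by (simp add: dist_commute)
  qed
  let ?P = "\<lambda>Y. finite Y \<and> Y \<subseteq> A \<and> separated_by \<delta> Y"
  have "?P {}"
    by (simp add: separated_by_def)
  then obtain Y where Y: "?P Y" "\<And>Z. ?P Z \<Longrightarrow> card Z \<le> card Y"
    using ex_has_greatest_nat[of ?P "{}" card "Suc (card T)"] bound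
    by (metis (no_types, lifting) less_Suc_eq_le)
  have "\<exists>y\<in>Y. dist y a \<le> \<delta>" if a: "a \<in> A" for a
  proof (rule ccontr)
    assume far: "\<not> ?thesis"
    then have "a \<notin> Y"
      using assms(2) by force
    moreover have "?P (insert a Y)"
      using far Y(1) a by (auto simp: separated_by_def pairwise_insert dist_commute not_le)
    ultimately show False
      using Y(2)[of "insert a Y"] Y(1) by simp
  qed
  then have "A \<subseteq> (\<Union>y\<in>Y. cball y \<delta>)"
    by auto
  then show ?thesis
    using that Y(1) by blast
qed

text \<open>
  The bound by the \<open>l\<^sup>1\<close> norm replaces the sharp factor \<open>sqrt d\<close> by \<open>d\<close>; dimensions are
  insensitive to such constants.
\<close>

lemma dist_le_if_in_cube:
  fixes x y a :: "real ^ 'n"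
  assumes "x \<in> cbox a (a + r *\<^sub>R 1)" and "y \<in> cbox a (a + r *\<^sub>R 1)"
  shows "dist x y \<le> real CARD('n) * r"
proof -
  have "\<bar>(x - y) $ i\<bar> \<le> r" for i
    using assms by (simp add: mem_box_cart abs_le_iff) (smt (verit, best))
  then have "(\<Sum>i\<in>UNIV. \<bar>(x - y) $ i\<bar>) \<le> real CARD('n) * r"
    using sum_bounded_above[of UNIV "\<lambda>i. \<bar>(x - y) $ i\<bar>" r] by simp
  then show ?thesis
    using norm_le_l1_cart[of "x - y"] by (simp add: dist_norm)
qed

lemma separated_card_le_covering_number:
  fixes A :: "(real ^ 'n) set"
  assumes "bounded A" and "0 < r" and "Y \<subseteq> A" and "separated_by (real CARD('n) * r) Y"
  shows "card Y \<le> covering_number r A"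
proof -
  obtain P where P: "finite P" "card P = covering_number r A"
    "A \<subseteq> (\<Union>a\<in>P. cbox a (a + r *\<^sub>R 1))"
    using covering_number_attained[OF assms(1,2)] .
  have "Y \<subseteq> (\<Union>a\<in>P. cbox a (a + r *\<^sub>R 1))"
    using P(3) assms(3) by blast
  from separated_card_le[OF P(1) this assms(4)] dist_le_if_in_cube P(2)
  show ?thesis by metis
qed

lemma covering_number_ge_1:
  fixes A :: "(real ^ 'n) set"
  assumes "bounded A" and "0 < r" and "A \<noteq> {}"
  shows "1 \<le> covering_number r A"
proof -
  obtain x where "x \<in> A"
    using assms(3) by blast
  then show ?thesis
    using separated_card_le_covering_number[OF assms(1,2), of "{x}"]
    by (simp add: separated_by_def)
qed

lemma covering_number_le_balls:
  fixes A :: "(real ^ 'n) set"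
  assumes "finite Q" and "A \<subseteq> (\<Union>q\<in>Q. cball q \<rho>)" and "2 * \<rho> \<le> r"
  shows "covering_number r A \<le> card Q"
proof -
  let ?h = "(r / 2) *\<^sub>R (1 :: real ^ 'n)"
  have "cball q \<rho> \<subseteq> cbox (q - ?h) (q - ?h + r *\<^sub>R 1)" for q :: "real ^ 'n"
  proof
    fix y assume "y \<in> cball q \<rho>"
    then have "\<bar>(q - y) $ i\<bar> \<le> r / 2" for i
      using component_le_norm_cart[of "q - y" i] assms(3) by (simp add: dist_norm)
    then have "\<bar>q $ i - y $ i\<bar> \<le> r / 2" for i
      by simp
    then show "y \<in> cbox (q - ?h) (q - ?h + r *\<^sub>R 1)"
      by (simp add: mem_box_cart) (smt (verit, best) field_sum_of_halves)
  qed
  then have "A \<subseteq> (\<Union>a\<in>(\<lambda>q. q - ?h) ` Q. cbox a (a + r *\<^sub>R 1))"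
    using assms(2) by fastforce
  then have "covering_number r A \<le> card ((\<lambda>q. q - ?h) ` Q)"
    unfolding covering_number_def using assms(1) by (intro Least_le) blast
  also have "\<dots> \<le> card Q"
    by (rule card_image_le[OF assms(1)])
  finally show ?thesis .
qed

section \<open>Bounds for the Hausdorff dimension\<close>

lemma hausdorff_dim_nonneg: "0 \<le> hausdorff_dim A"
  unfolding hausdorff_dim_def by (rule Inf_greatest) auto

lemma hausdorff_dim_leI:
  assumes "0 \<le> s" and "\<And>s'. s < s' \<Longrightarrow> hausdorff_measure s' E = 0"
  shows "hausdorff_dim E \<le> ereal s"
proof (rule ereal_le_epsilon2)
  fix e :: real assume "0 < e"
  then have "hausdorff_measure (s + e) E = 0" "0 \<le> s + e"
    using assms by auto
  then show "hausdorff_dim E \<le> ereal s + ereal e"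
    unfolding hausdorff_dim_def by (intro Inf_lower) auto
qed

text \<open>
  A maximal \<open>\<delta>\<close>-separated set gives a cover by balls of radius \<open>\<delta>\<close>, whose \<open>s'\<close>-cost is
  at most a constant times \<open>\<delta>\<close> to the power \<open>s' - s\<close>. For \<open>s' > s\<close> this vanishes along the
  sequence of scales; so one sequence of scales tending to \<open>0\<close> suffices.
\<close>

lemma hausdorff_dim_le_if_separated_bound:
  fixes E :: "'a::euclidean_space set" and \<delta> :: "nat \<Rightarrow> real"
  assumes "bounded E" and "0 \<le> s" and "\<delta> \<longlonglongrightarrow> 0" and pos: "\<And>m. 0 < \<delta> m"
    and bound: "\<And>m Y. finite Y \<Longrightarrow> Y \<subseteq> E \<Longrightarrow> separated_by (\<delta> m) Y \<Longrightarrow>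
      real (card Y) \<le> C * (1 / \<delta> m) powr s"
  shows "hausdorff_dim E \<le> ereal s"
proof (rule hausdorff_dim_leI[OF assms(2)])
  fix s' assume s': "s < s'"
  have "hausdorff_premeasure s' \<epsilon> E = 0" if "0 < \<epsilon>" for \<epsilon>
  proof -
    have "hausdorff_premeasure s' \<epsilon> E \<le> ennreal (C * 2 powr s' * \<delta> m powr (s' - s))"
      if small: "2 * \<delta> m < \<epsilon>" for m
    proof -
      obtain Y where Y: "finite Y" "Y \<subseteq> E" "separated_by (\<delta> m) Y" "E \<subseteq> (\<Union>y\<in>Y. cball y (\<delta> m))"
        using ex_separated_net[OF assms(1) pos] .
      obtain f where f: "bij_betw f {..<card Y} Y"
        using Y(1) ex_bij_betw_nat_finite atLeast0LessThan by metis
      define U where "U = (\<lambda>i. if i < card Y then cball (f i) (\<delta> m) else {})"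
      have diam: "diameter (U i) \<le> 2 * \<delta> m" for i
      proof (cases "i < card Y")
        case True
        have "dist x y \<le> 2 * \<delta> m" if "x \<in> U i" "y \<in> U i" for x y
          using that True dist_triangle2[of x y "f i"] by (simp add: U_def dist_commute)
        then show ?thesis
          using pos[of m] by (intro diameter_le) (auto simp: dist_norm)
      qed (use pos[of m] in \<open>simp add: U_def\<close>)
      have bnd: "bounded (U i)" for i
        by (simp add: U_def)
      have "E \<subseteq> (\<Union>i. U i)"
      proof
        fix x assume "x \<in> E"
        then obtain y where "y \<in> Y" "x \<in> cball y (\<delta> m)"
          using Y(4) by blast
        moreover from this(1) obtain i where "i < card Y" "f i = y"
          using f by (metis bij_betw_def imageE lessThan_iff)
        ultimately show "x \<in> (\<Union>i. U i)"
          by (auto simp: U_def)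
      qed
      then have "hausdorff_premeasure s' \<epsilon> E \<le> (\<Sum>i. diam_power s' (U i))"
        unfolding hausdorff_premeasure_def
        using diam bnd small by (intro Inf_lower) (auto intro!: exI[of _ U] order_trans[OF diam])
      also have "\<dots> = (\<Sum>i<card Y. diam_power s' (U i))"
        by (rule suminf_finite) (auto simp: U_def diam_power_def)
      also have "\<dots> \<le> (\<Sum>i<card Y. ennreal ((2 * \<delta> m) powr s'))"
      proof (rule sum_mono)
        fix i
        have "diameter (U i) powr s' \<le> (2 * \<delta> m) powr s'"
          using diam[of i] s' assms(2) diameter_ge_0[OF bnd] by (intro powr_mono2) auto
        then show "diam_power s' (U i) \<le> ennreal ((2 * \<delta> m) powr s')"
          using s' assms(2) by (auto simp: diam_power_def ennreal_leI)
      qed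
      also have "\<dots> = ennreal (card Y * (2 * \<delta> m) powr s')"
        by (simp add: ennreal_mult ennreal_of_nat_eq_real_of_nat)
      also have "\<dots> \<le> ennreal (C * (1 / \<delta> m) powr s * (2 * \<delta> m) powr s')"
        using bound[OF Y(1-3)] by (intro ennreal_leI mult_right_mono) auto
      also have "C * (1 / \<delta> m) powr s * (2 * \<delta> m) powr s' = C * 2 powr s' * \<delta> m powr (s' - s)"
        using pos[of m] by (simp add: powr_mult powr_divide powr_diff field_simps)
      finally show ?thesis .
    qed
    moreover have "eventually (\<lambda>m. 2 * \<delta> m < \<epsilon>) sequentially"
    proof -
      have "eventually (\<lambda>m. \<delta> m < \<epsilon> / 2) sequentially"
        using order_tendstoD(2)[OF assms(3), of "\<epsilon> / 2"] that by simp
      then show ?thesis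
        by eventually_elim simp
    qed
    ultimately have ev: "eventually (\<lambda>m. hausdorff_premeasure s' \<epsilon> E \<le>
        ennreal (C * 2 powr s' * \<delta> m powr (s' - s))) sequentially"
      by (metis (mono_tags, lifting) eventually_mono)
    have "(\<lambda>m. \<delta> m powr (s' - s)) \<longlonglongrightarrow> 0 powr (s' - s)"
      using assms(3) s' pos by (intro tendsto_powr') (auto simp: less_imp_le)
    then have "(\<lambda>m. C * 2 powr s' * \<delta> m powr (s' - s)) \<longlonglongrightarrow> C * 2 powr s' * 0"
      by (intro tendsto_mult) auto
    then have "(\<lambda>m. ennreal (C * 2 powr s' * \<delta> m powr (s' - s))) \<longlonglongrightarrow> ennreal 0"
      by (intro tendsto_ennrealI) simp
    from tendsto_lowerbound[OF this ev] show ?thesis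
      by simp
  qed
  then show "hausdorff_measure s' E = 0"
    by (simp add: hausdorff_measure_def)
qed

text \<open>
  Reduction to finite covers by balls centred in \<open>E\<close>: if \<open>E\<close> has measure \<open>0\<close> in a dimension
  below \<open>t\<close>, then countable covers with arbitrarily small \<open>t\<close>-cost exist. A covering set
  that meets \<open>E\<close> is swallowed by an open ball around one of its points in \<open>E\<close> with radius slightly
  above the diameter, and compactness leaves finitely many of these balls.
\<close>

lemma hausdorff_dim_ge_if_finite_covers:
  fixes E :: "'a::metric_space set"
  assumes "compact E" and "0 < t" and "0 < c"
    and cov: "\<And>P. finite P \<Longrightarrow> P \<subseteq> E \<times> {0<..} \<Longrightarrow> E \<subseteq> (\<Union>(u, r)\<in>P. ball u r) \<Longrightarrow>
      c \<le> (\<Sum>(u, r)\<in>P. r powr t)"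
  shows "ereal t \<le> hausdorff_dim E"
proof -
  have "t \<le> s" if s: "0 \<le> s" and null: "hausdorff_measure s E = 0" for s
  proof (rule ccontr)
    assume "\<not> t \<le> s"
    then have "s < t" by simp
    have "hausdorff_premeasure s 1 E \<le> hausdorff_measure s E"
      unfolding hausdorff_measure_def by (rule SUP_upper) simp
    then have "hausdorff_premeasure s 1 E < ennreal (c / 2)"
      using null assms(3) by simp
    then obtain U :: "nat \<Rightarrow> 'a set" where U: "E \<subseteq> (\<Union>i. U i)" "\<And>i. bounded (U i)"
      "\<And>i. diameter (U i) \<le> 1" "(\<Sum>i. diam_power s (U i)) < ennreal (c / 2)"
      unfolding hausdorff_premeasure_def Inf_less_iff by auto
    define a where "a i = diameter (U i) powr t" for i
    \<comment> \<open>The increments \<open>c / 2 ^ (i + 2)\<close> make every radius exceed the diameter of its set, also when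
        that diameter is \<open>0\<close>, and add only \<open>c / 2\<close> to the total cost.\<close>
    define r where "r i = (a i + c / 2 * (1 / 2) ^ Suc i) powr (1 / t)" for i
    have a0: "0 \<le> a i" for i
      by (simp add: a_def)
    have inc_pos: "0 < c / 2 * (1 / 2) ^ Suc i" for i
      using assms(3) by (intro mult_pos_pos zero_less_power) auto
    have inner_pos: "0 < a i + c / 2 * (1 / 2) ^ Suc i" for i
      using a0[of i] assms(3) by (simp add: add_nonneg_pos)
    have rt: "r i powr t = a i + c / 2 * (1 / 2) ^ Suc i" for i
      using inner_pos[of i] assms(2) by (simp add: r_def powr_powr)
    have rpos: "0 < r i" for i
      using inner_pos[of i] by (simp add: r_def)
    have diam_r: "diameter (U i) < r i" for i
    proof (rule ccontr)
      assume "\<not> ?thesis"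
      then have "r i powr t \<le> diameter (U i) powr t"
        using rpos[of i] assms(2) by (intro powr_mono2) auto
      then show False
        using rt[of i] inc_pos[of i] unfolding a_def by linarith
    qed
    have a_le: "ennreal (a i) \<le> diam_power s (U i)" for i
    proof -
      have d: "0 \<le> diameter (U i)" "diameter (U i) \<le> 1"
        using U(2,3) diameter_ge_0 by auto
      show ?thesis
        using \<open>s < t\<close> powr_mono'[of s t "diameter (U i)"] powr_le1[of t "diameter (U i)"] d assms(2)
        by (auto simp: a_def diam_power_def ennreal_leI)
    qed
    have "(\<Sum>i. ennreal (r i powr t)) = (\<Sum>i. ennreal (a i) + ennreal (c / 2 * (1 / 2) ^ Suc i))"
      using a0 assms(3) by (simp add: rt ennreal_plus)
    also have "\<dots> = (\<Sum>i. ennreal (a i)) + (\<Sum>i. ennreal (c / 2 * (1 / 2) ^ Suc i))"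
      by (rule suminf_add[symmetric]) auto
    also have "(\<Sum>i. ennreal (c / 2 * (1 / 2) ^ Suc i)) = ennreal (c / 2)"
    proof (rule suminf_ennreal_eq)
      show "(\<lambda>i. c / 2 * (1 / 2) ^ Suc i) sums (c / 2)"
        using sums_mult[OF power_half_series, of "c / 2"] by simp
    qed (use assms(3) in auto)
    also have "(\<Sum>i. ennreal (a i)) + ennreal (c / 2) < ennreal (c / 2) + ennreal (c / 2)"
      using order_le_less_trans[OF suminf_le[of "\<lambda>i. ennreal (a i)", OF a_le summableI summableI] U(4)]
      by (subst add.commute) (auto simp: ennreal_add_left_cancel_less intro: le_less_trans)
    also have "\<dots> = ennreal c"
      using assms(3) by (simp flip: ennreal_plus)
    finally have total: "(\<Sum>i. ennreal (r i powr t)) < ennreal c" .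
    define J where "J = {i. U i \<inter> E \<noteq> {}}"
    have "\<forall>i\<in>J. \<exists>x. x \<in> U i \<inter> E"
      by (auto simp: J_def)
    then obtain u where u: "\<And>i. i \<in> J \<Longrightarrow> u i \<in> U i \<inter> E"
      by metis
    have "E \<subseteq> (\<Union>i\<in>J. ball (u i) (r i))"
    proof
      fix x assume x: "x \<in> E"
      then obtain i where i: "x \<in> U i"
        using U(1) by blast
      then have "i \<in> J"
        using x by (auto simp: J_def)
      moreover have "dist (u i) x \<le> diameter (U i)"
        using u[OF \<open>i \<in> J\<close>] i U(2) by (intro diameter_bounded_bound) auto
      ultimately show "x \<in> (\<Union>i\<in>J. ball (u i) (r i))"
        using diam_r[of i] by fastforce
    qed
    then obtain I where I: "I \<subseteq> J" "finite I" "E \<subseteq> (\<Union>i\<in>I. ball (u i) (r i))"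
      using compactE_image[OF assms(1), of J "\<lambda>i. ball (u i) (r i)"] by (metis open_ball)
    let ?P = "(\<lambda>i. (u i, r i)) ` I"
    have "c \<le> (\<Sum>(u, r)\<in>?P. r powr t)"
      using I u rpos by (intro cov) auto
    also have "\<dots> \<le> (\<Sum>i\<in>I. r i powr t)"
      using sum_image_le[OF I(2), of "\<lambda>(u, r). r powr t" "\<lambda>i. (u i, r i)"] by (simp add: o_def)
    finally have "ennreal c \<le> (\<Sum>i\<in>I. ennreal (r i powr t))"
      by (simp add: sum_nonneg ennreal_leI)
    also have "\<dots> \<le> (\<Sum>i. ennreal (r i powr t))"
      using I(2) by (intro sum_le_suminf) auto
    finally show False
      using total by simp
  qed
  then show ?thesis
    unfolding hausdorff_dim_def by (intro Inf_greatest) auto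
qed

section \<open>Hausdorff convergence\<close>

lemma hausdorff_distance_commute: "hausdorff_distance A B = hausdorff_distance B A"
  by (simp add: hausdorff_distance_def max.commute)

lemma hausdorff_distance_lessE:
  assumes "hausdorff_distance A B < \<eta>" and "bounded A" and "B \<noteq> {}" and "a \<in> A"
  obtains b where "b \<in> B" "dist a b < \<eta>"
proof -
  obtain b0 where b0: "b0 \<in> B"
    using assms(3) by blast
  obtain K where K: "\<And>x. x \<in> A \<Longrightarrow> dist b0 x \<le> K"
    using assms(2) by (metis bounded_any_center)
  have "infdist x B \<le> K" if "x \<in> A" for x
    using infdist_le2[OF b0] K[OF that] by (simp add: dist_commute)
  then have "bdd_above ((\<lambda>a. infdist a B) ` A)"
    by (auto intro!: bdd_aboveI)
  then have "infdist a B \<le> (SUP a\<in>A. infdist a B)"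
    using assms(4) by (intro cSUP_upper)
  then have "infdist a B < \<eta>"
    using assms(1) by (simp add: hausdorff_distance_def)
  then show ?thesis
    using that assms(3) by (auto simp: infdist_def cINF_less_iff)
qed

lemma hausdorff_distance_leI:
  assumes "A \<noteq> {}" and "B \<noteq> {}"
    and "\<And>a. a \<in> A \<Longrightarrow> infdist a B \<le> \<eta>" and "\<And>b. b \<in> B \<Longrightarrow> infdist b A \<le> \<eta>"
  shows "hausdorff_distance A B \<le> \<eta>"
  unfolding hausdorff_distance_def using assms by (auto intro!: cSUP_least)

lemma hausdorff_distance_nonneg:
  assumes "A \<noteq> {}" and "bounded A" and "B \<noteq> {}"
  shows "0 \<le> hausdorff_distance A B"
proof (rule ccontr)
  assume "\<not> ?thesis"
  moreover obtain a where "a \<in> A"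
    using assms(1) by blast
  ultimately obtain b where "dist a b < 0"
    using hausdorff_distance_lessE[of A B 0 a] assms by auto
  then show False
    by (simp add: not_less[symmetric])
qed

text \<open>
  Moving each point by less than \<open>\<eta>\<close> costs at most \<open>2 * \<eta>\<close> of separation and keeps the points
  distinct. This is how counts of separated points pass between minisets and microsets.
\<close>

lemma separated_transfer:
  assumes "hausdorff_distance A B < \<eta>" and "bounded A" and "B \<noteq> {}"
    and "finite Y" and "Y \<subseteq> A" and "separated_by \<delta> Y" and "\<delta>' + 2 * \<eta> \<le> \<delta>" and "0 \<le> \<delta>'"
  obtains Z where "finite Z" "Z \<subseteq> B" "card Z = card Y" "separated_by \<delta>' Z"
    "\<And>z. z \<in> Z \<Longrightarrow> \<exists>y\<in>Y. dist y z < \<eta>"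
proof -
  have "\<exists>b\<in>B. dist y b < \<eta>" if "y \<in> Y" for y
    using hausdorff_distance_lessE[OF assms(1-3), of y] that assms(5) by blast
  then obtain f where f: "\<And>y. y \<in> Y \<Longrightarrow> f y \<in> B \<and> dist y (f y) < \<eta>"
    by metis
  have far: "\<delta>' < dist (f x) (f y)" if "x \<in> Y" "y \<in> Y" "x \<noteq> y" for x y
  proof -
    have "dist x y \<le> dist x (f x) + dist (f x) (f y) + dist y (f y)"
      by (metis add.commute add_right_mono dist_commute dist_triangle dist_triangle_le order_trans)
    then show ?thesis
      using separated_byD[OF assms(6) that] f[OF that(1)] f[OF that(2)] assms(7) by linarith
  qed
  have "inj_on f Y"
    using far assms(8) by (intro inj_onI) (metis dist_self not_less)
  then have "card (f ` Y) = card Y"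
    by (rule card_image)
  moreover have "separated_by \<delta>' (f ` Y)"
    using far by (intro separated_byI) auto
  ultimately show ?thesis
    using that[of "f ` Y"] f assms(4) by blast
qed

text \<open>
  The distance functions of the sets are uniformly bounded and 1-Lipschitz on \<open>X\<close>, so by the
  theorem of Arzela and Ascoli a subsequence converges uniformly to some \<open>g\<close>. The zero set of \<open>g\<close>
  is the limit in the Hausdorff metric.
\<close>

lemma hausdorff_compactness:
  fixes D :: "nat \<Rightarrow> 'a::euclidean_space set"
  assumes "compact X" and D: "\<And>k. compact (D k)" "\<And>k. D k \<noteq> {}" "\<And>k. D k \<subseteq> X"
  obtains E \<sigma> where "strict_mono (\<sigma> :: nat \<Rightarrow> nat)" "compact E" "E \<noteq> {}" "E \<subseteq> X"
    "(\<lambda>k. hausdorff_distance (D (\<sigma> k)) E) \<longlonglongrightarrow> 0"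
proof -
  obtain M where M: "\<And>x y. x \<in> X \<Longrightarrow> y \<in> X \<Longrightarrow> dist x y \<le> M"
    using compact_imp_bounded[OF assms(1)] by (metis diameter_bounded_bound)
  have le_M: "norm (infdist x (D k)) \<le> M" if "x \<in> X" for x k
  proof -
    obtain y where "y \<in> D k"
      using D(2) by blast
    then show ?thesis
      using infdist_le2[of y "D k" x M] M[OF that, of y] D(3) infdist_nonneg[of x "D k"] by auto
  qed
  have lip: "norm (infdist x (D k) - infdist y (D k)) \<le> norm (x - y)" for x y k
    using infdist_triangle_abs[of x "D k" y] by (simp add: dist_norm)
  obtain g \<sigma> where g: "continuous_on X g" and \<sigma>: "strict_mono (\<sigma> :: nat \<Rightarrow> nat)"
    and lim: "\<And>e. 0 < e \<Longrightarrow> \<exists>N. \<forall>n x. N \<le> n \<and> x \<in> X \<longrightarrow> norm (infdist x (D (\<sigma> n)) - g x) < e"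
    using Arzela_Ascoli[OF assms(1), of "\<lambda>k x. infdist x (D k)" M] le_M lip
    by (smt (verit, ccfv_threshold))
  define E where "E = {x \<in> X. g x = 0}"
  have "closed E"
    unfolding E_def by (rule continuous_closed_preimage_constant[OF g compact_imp_closed[OF assms(1)]])
  then have E: "compact E" "E \<subseteq> X"
    using compact_Int_closed[OF assms(1), of E] by (auto simp: E_def Int_absorb1 subset_iff)
  have g_nonneg: "0 \<le> g x" if "x \<in> X" for x
  proof (rule field_le_epsilon)
    fix e :: real assume "0 < e"
    then obtain N where "\<forall>n x. N \<le> n \<and> x \<in> X \<longrightarrow> norm (infdist x (D (\<sigma> n)) - g x) < e"
      using lim by blast
    then have "norm (infdist x (D (\<sigma> N)) - g x) < e"
      using that by simp
    then show "0 \<le> g x + e"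
      using infdist_nonneg[of x "D (\<sigma> N)"] by (simp add: abs_less_iff)
  qed
  have g_small: "\<exists>N. \<forall>n\<ge>N. \<forall>x\<in>D (\<sigma> n). g x < e" if e: "0 < e" for e
  proof -
    obtain N where N: "\<And>n x. N \<le> n \<Longrightarrow> x \<in> X \<Longrightarrow> norm (infdist x (D (\<sigma> n)) - g x) < e"
      using lim[OF e] by blast
    have "g x < e" if "N \<le> n" "x \<in> D (\<sigma> n)" for n x
      using N[OF that(1), of x] that(2) D(3) by (auto simp: abs_less_iff)
    then show ?thesis
      by blast
  qed
  have "X \<noteq> {}"
    using D(2,3) by blast
  then obtain x0 where x0: "x0 \<in> X" "\<And>y. y \<in> X \<Longrightarrow> g x0 \<le> g y"
    using continuous_attains_inf[OF assms(1) _ g] by blast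
  have "g x0 \<le> 0"
  proof (rule field_le_epsilon)
    fix e :: real assume "0 < e"
    then obtain N where "\<forall>x\<in>D (\<sigma> N). g x < e"
      using g_small by blast
    then show "g x0 \<le> 0 + e"
      using D(2)[of "\<sigma> N"] D(3)[of "\<sigma> N"] x0(2) by fastforce
  qed
  then have ne: "E \<noteq> {}"
    using x0(1) g_nonneg[OF x0(1)] by (auto simp: E_def)
  \<comment> \<open>Away from its zero set \<open>E\<close>, the function \<open>g\<close> is bounded below by compactness.\<close>
  have near_E: "\<exists>\<epsilon>>0. \<forall>x\<in>X. g x < \<epsilon> \<longrightarrow> infdist x E \<le> e" if e: "0 < e" for e
  proof (cases "{x \<in> X. e \<le> infdist x E} = {}")
    case True
    then show ?thesis
      by (intro exI[of _ 1]) (auto simp: not_le less_imp_le)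
  next
    case False
    have "closed {x. e \<le> infdist x E}"
      by (intro closed_Collect_le continuous_intros)
    then have cpt: "compact {x \<in> X. e \<le> infdist x E}"
      using compact_Int_closed[OF assms(1)] by (simp add: Collect_conj_eq)
    obtain z where z: "z \<in> X" "e \<le> infdist z E"
      and le: "\<And>y. y \<in> X \<Longrightarrow> e \<le> infdist y E \<Longrightarrow> g z \<le> g y"
      using continuous_attains_inf[OF cpt False continuous_on_subset[OF g]] by auto
    have "g z \<noteq> 0"
      using z e by (auto simp: E_def)
    then have "0 < g z"
      using g_nonneg[OF z(1)] by simp
    then show ?thesis
      using le by (intro exI[of _ "g z"]) (metis less_le_not_le linear)
  qed
  have "(\<lambda>k. hausdorff_distance (D (\<sigma> k)) E) \<longlonglongrightarrow> 0"
  proof (rule LIMSEQ_I)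
    fix r :: real assume r: "0 < r"
    define e where "e = r / 2"
    have e: "0 < e" "e < r"
      using r by (auto simp: e_def)
    obtain \<epsilon> where \<epsilon>: "0 < \<epsilon>" "\<And>x. x \<in> X \<Longrightarrow> g x < \<epsilon> \<Longrightarrow> infdist x E \<le> e"
      using near_E[OF e(1)] by blast
    obtain N1 where N1: "\<And>n x. N1 \<le> n \<Longrightarrow> x \<in> D (\<sigma> n) \<Longrightarrow> g x < \<epsilon>"
      using g_small[OF \<epsilon>(1)] by blast
    obtain N2 where N2: "\<And>n x. N2 \<le> n \<Longrightarrow> x \<in> X \<Longrightarrow> norm (infdist x (D (\<sigma> n)) - g x) < e"
      using lim[OF e(1)] by blast
    have "norm (hausdorff_distance (D (\<sigma> n)) E - 0) < r" if n: "max N1 N2 \<le> n" for n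
    proof -
      have "infdist x E \<le> e" if "x \<in> D (\<sigma> n)" for x
        using \<epsilon>(2) N1[of n x] that n D(3) by auto
      moreover have "infdist x (D (\<sigma> n)) \<le> e" if "x \<in> E" for x
        using N2[of n x] that n by (auto simp: E_def)
      ultimately have "hausdorff_distance (D (\<sigma> n)) E \<le> e"
        using hausdorff_distance_leI D(2) ne by metis
      then show ?thesis
        using hausdorff_distance_nonneg[OF D(2) compact_imp_bounded[OF D(1)] ne, of "\<sigma> n"] e(2) by simp
    qed
    then show "\<exists>N. \<forall>n\<ge>N. norm (hausdorff_distance (D (\<sigma> n)) E - 0) < r"
      by blast
  qed
  then show ?thesis
    using that \<sigma> E ne by blast
qed

section \<open>Zooming in\<close>

lemma dist_similarity:
  fixes t :: "'a::real_normed_vector"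
  assumes "0 < c"
  shows "dist (c *\<^sub>R x + t) (c *\<^sub>R y + t) = c * dist x y"
  using assms by (simp add: dist_norm flip: scaleR_diff_right)

lemma separated_image_similarity:
  fixes t :: "'a::real_normed_vector"
  assumes "separated_by \<delta> Y" and "0 < c"
  shows "separated_by (c * \<delta>) ((\<lambda>x. c *\<^sub>R x + t) ` Y)"
    and "card ((\<lambda>x. c *\<^sub>R x + t) ` Y) = card Y"
proof -
  show "separated_by (c * \<delta>) ((\<lambda>x. c *\<^sub>R x + t) ` Y)"
    using assms by (intro separated_byI) (auto simp: dist_similarity separated_byD simp del: dist_add_cancel2)
  show "card ((\<lambda>x. c *\<^sub>R x + t) ` Y) = card Y"
    using assms(2) by (intro card_image inj_onI) simp
qed

lemma separated_preimage_similarity: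
  fixes t :: "'a::real_normed_vector"
  assumes "separated_by \<delta> Y" and "0 < c" and "finite Y" and "Y \<subseteq> (\<lambda>x. c *\<^sub>R x + t) ` A"
  obtains Z where "finite Z" "Z \<subseteq> A" "Y = (\<lambda>x. c *\<^sub>R x + t) ` Z" "card Z = card Y"
    "separated_by (\<delta> / c) Z"
proof -
  let ?f = "\<lambda>x. (1 / c) *\<^sub>R x + (- (1 / c)) *\<^sub>R t"
  have inv: "c *\<^sub>R ?f y + t = y" "?f (c *\<^sub>R y + t) = y" for y
    using assms(2) by (simp_all add: scaleR_add_right scaleR_diff_right)
  show ?thesis
  proof (rule that[of "?f ` Y"])
    show "?f ` Y \<subseteq> A"
      using assms(4) inv(2) by fastforce
    show "Y = (\<lambda>x. c *\<^sub>R x + t) ` ?f ` Y"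
      using inv(1) by (simp add: image_image)
    show "card (?f ` Y) = card Y" "separated_by (\<delta> / c) (?f ` Y)"
      using separated_image_similarity[OF assms(1), of "1 / c" "(- (1 / c)) *\<^sub>R t"] assms(2)
      by simp_all
  qed (use assms(3) in simp)
qed

text \<open>
  The similarity of ratio \<open>c\<close> that puts \<open>y\<close> at the centre of the unit cube, so that limits of
  zooms at points of \<open>F\<close> contain the centre and therefore meet the interior of the cube.
\<close>

definition zoom :: "(real ^ 'n) set \<Rightarrow> real ^ 'n \<Rightarrow> real \<Rightarrow> (real ^ 'n) set" where
  "zoom F y c = (\<lambda>x. c *\<^sub>R x + ((1 / 2) *\<^sub>R 1 - c *\<^sub>R y)) ` F \<inter> cbox 0 1"

lemma centre_in_cube: "(1 / 2) *\<^sub>R (1 :: real ^ 'n) \<in> box 0 1"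
  by (simp add: mem_box_cart)

lemma zoom_props:
  assumes "compact F" and "y \<in> F" and "1 \<le> c"
  shows "compact (zoom F y c)" and "(1 / 2) *\<^sub>R 1 \<in> zoom F y c" and "zoom F y c \<subseteq> cbox 0 1"
    and "miniset F (zoom F y c)"
proof -
  show cpt: "compact (zoom F y c)"
    unfolding zoom_def
    by (intro compact_Int compact_cbox compact_continuous_image assms continuous_intros)
  show mem: "(1 / 2) *\<^sub>R 1 \<in> zoom F y c"
    unfolding zoom_def using assms(2) centre_in_cube box_subset_cbox[of 0 1] by force
  show sub: "zoom F y c \<subseteq> cbox 0 1"
    by (simp add: zoom_def)
  have "zoom F y c \<noteq> {}"
    using mem by blast
  then show "miniset F (zoom F y c)"
    unfolding miniset_def unit_cube_compacts_def using cpt sub assms(3) by (auto simp: zoom_def)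
qed

lemma zoom_limit:
  fixes F :: "(real ^ 'n) set"
  assumes "compact F" and "\<And>k. y k \<in> F" and "\<And>k. 1 \<le> c k"
  obtains E \<sigma> where "strict_mono (\<sigma> :: nat \<Rightarrow> nat)" "E \<in> gallery F"
    "(\<lambda>k. hausdorff_distance (zoom F (y (\<sigma> k)) (c (\<sigma> k))) E) \<longlonglongrightarrow> 0"
proof -
  let ?D = "\<lambda>k. zoom F (y k) (c k)"
  note D = zoom_props[OF assms]
  obtain E \<sigma> where E: "strict_mono (\<sigma> :: nat \<Rightarrow> nat)" "compact E" "E \<noteq> {}" "E \<subseteq> cbox 0 1"
    "(\<lambda>k. hausdorff_distance (?D (\<sigma> k)) E) \<longlonglongrightarrow> 0"
  proof (rule hausdorff_compactness[of "cbox 0 1" ?D])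
    show "?D k \<noteq> {}" for k
      using D(2)[of k] by blast
  qed (use D in auto)
  have "\<exists>e\<in>E. dist e ((1 / 2) *\<^sub>R 1) < r" if r: "0 < r" for r
  proof -
    obtain k where "hausdorff_distance (?D (\<sigma> k)) E < r"
      using eventually_happens'[OF sequentially_bot order_tendstoD(2)[OF E(5) r]] by blast
    from hausdorff_distance_lessE[OF this compact_imp_bounded[OF D(1)] E(3) D(2)]
    obtain e where "e \<in> E" "dist ((1 / 2) *\<^sub>R 1) e < r" .
    then show ?thesis
      by (auto simp: dist_commute)
  qed
  then have "(1 / 2) *\<^sub>R 1 \<in> E"
    using closed_approachable[OF compact_imp_closed[OF E(2)]] by blast
  then have "E \<inter> box 0 1 \<noteq> {}"
    using centre_in_cube by blast
  moreover have "microset F E"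
  proof -
    have "miniset F (?D (\<sigma> k))" for k
      by (rule D(4))
    moreover have "E \<in> unit_cube_compacts"
      using E(2-4) by (simp add: unit_cube_compacts_def)
    ultimately show ?thesis
      unfolding microset_def using E(5) by (intro conjI exI[of _ "\<lambda>k. ?D (\<sigma> k)"] allI)
  qed
  ultimately show ?thesis
    using that[OF E(1) _ E(5)] by (simp add: gallery_def)
qed

lemma microset_close_miniset:
  fixes F E :: "(real ^ 'n) set"
  assumes "microset F E" and "0 < \<eta>"
  obtains D c t where "1 \<le> c" "D = (\<lambda>x. c *\<^sub>R x + t) ` F \<inter> cbox 0 1" "D \<noteq> {}"
    "bounded D" "hausdorff_distance D E < \<eta>"
proof -
  obtain D where D: "\<And>k. miniset F (D k)" "(\<lambda>k. hausdorff_distance (D k) E) \<longlonglongrightarrow> 0"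
    using assms(1) unfolding microset_def by blast
  obtain k where close: "hausdorff_distance (D k) E < \<eta>"
    using eventually_happens'[OF sequentially_bot order_tendstoD(2)[OF D(2) assms(2)]] by blast
  obtain c t where ct: "1 \<le> c" "D k = (\<lambda>x. c *\<^sub>R x + t) ` F \<inter> cbox 0 1"
    using D(1)[of k] by (auto simp: miniset_def)
  have "D k \<noteq> {}" "bounded (D k)"
    using D(1)[of k] by (auto simp: miniset_def unit_cube_compacts_def compact_imp_bounded)
  then show ?thesis
    by (rule that[OF ct _ _ close])
qed

section \<open>Dimension bounds for every gallery element\<close>

text \<open>
  A miniset lies in a cube of side \<open>1\<close>, hence comes from a ball of \<open>F\<close> of radius
  comparable with \<open>1 / c\<close>, where \<open>c\<close> is its ratio. The Assouad bound is invariant under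
  this scaling, so it bounds the number of \<open>\<delta>\<close>-separated points in all minisets by the same
  multiple of \<open>(1 / \<delta>) powr s\<close>, and this bound survives the limit.
\<close>

lemma hausdorff_dim_microset_le_assouad_dim:
  fixes F :: "(real ^ 'n) set"
  assumes "compact F" and "microset F E"
  shows "hausdorff_dim E \<le> assouad_dim F"
  unfolding assouad_dim_def
proof (rule Inf_greatest, clarify)
  fix s C :: real
  assume s: "0 \<le> s" and C: "0 < C"
    and cov: "\<forall>R r. \<forall>x\<in>F. 0 < R \<and> 0 < r \<and> r < R \<longrightarrow>
      real (covering_number r (cball x R \<inter> F)) \<le> C * (R / r) powr s"
  define d where "d = real CARD('n)"
  have d: "1 \<le> d"
    by (simp add: d_def Suc_leI)
  have E: "E \<noteq> {}" "compact E"
    using assms(2) by (auto simp: microset_def unit_cube_compacts_def)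
  define \<delta> where "\<delta> m = inverse (real (Suc m))" for m
  have \<delta>: "0 < \<delta> m" "\<delta> m \<le> 1" for m
    by (simp_all add: \<delta>_def field_simps)
  show "hausdorff_dim E \<le> ereal s"
  proof (rule hausdorff_dim_le_if_separated_bound[OF compact_imp_bounded[OF E(2)] s])
    show "\<delta> \<longlonglongrightarrow> 0"
      unfolding \<delta>_def by (rule LIMSEQ_inverse_real_of_nat)
    show "real (card Y) \<le> C * (2 * d\<^sup>2) powr s * (1 / \<delta> m) powr s"
      if Y: "finite Y" "Y \<subseteq> E" "separated_by (\<delta> m) Y" for m Y
    proof (cases "Y = {}")
      case True
      then show ?thesis
        using C by simp
    next
      case False
      have "0 < \<delta> m / 4"
        using \<delta>(1)[of m] by simp
      then obtain D c t where c: "1 \<le> c" and D: "D = (\<lambda>x. c *\<^sub>R x + t) ` F \<inter> cbox 0 1"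
        "D \<noteq> {}" "bounded D" and close: "hausdorff_distance D E < \<delta> m / 4"
        by (rule microset_close_miniset[OF assms(2)])
      have "hausdorff_distance E D < \<delta> m / 4" "\<delta> m / 2 + 2 * (\<delta> m / 4) \<le> \<delta> m" "0 \<le> \<delta> m / 2"
        using close \<delta>(1)[of m] by (simp_all add: hausdorff_distance_commute)
      from separated_transfer[OF this(1) compact_imp_bounded[OF E(2)] D(2) Y this(2,3)]
      obtain Z where Z: "finite Z" "Z \<subseteq> D" "card Z = card Y" "separated_by (\<delta> m / 2) Z"
        by metis
      have c0: "0 < c"
        using c by simp
      have "Z \<subseteq> (\<lambda>x. c *\<^sub>R x + t) ` F"
        using Z(2) D(1) by simp
      then obtain W where W: "finite W" "W \<subseteq> F" "Z = (\<lambda>x. c *\<^sub>R x + t) ` W" "card W = card Z"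
        "separated_by (\<delta> m / 2 / c) W"
        by (rule separated_preimage_similarity[OF Z(4) c0 Z(1)])
      have "W \<noteq> {}"
        using W(4) Z(1,3) False Y(1) by auto
      then obtain x where x: "x \<in> W"
        by blast
      have "W \<subseteq> cball x (d / c) \<inter> F"
      proof
        fix y assume y: "y \<in> W"
        have "c *\<^sub>R x + t \<in> cbox 0 (0 + 1 *\<^sub>R 1)" "c *\<^sub>R y + t \<in> cbox 0 (0 + 1 *\<^sub>R 1)"
          using x y W(3) Z(2) D(1) by auto
        from dist_le_if_in_cube[OF this] have "c * dist x y \<le> d"
          unfolding dist_similarity[OF c0] by (simp add: d_def)
        then show "y \<in> cball x (d / c) \<inter> F"
          using y W(2) c0 by (auto simp: field_simps)
      qed
      moreover have "separated_by (real CARD('n) * (\<delta> m / (2 * c * d))) W"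
        using W(5) d by (simp add: d_def)
      moreover have "bounded (cball x (d / c) \<inter> F)"
        by (simp add: bounded_Int)
      ultimately have "card W \<le> covering_number (\<delta> m / (2 * c * d)) (cball x (d / c) \<inter> F)"
        using c0 d \<delta>(1)[of m] by (intro separated_card_le_covering_number) auto
      moreover have "\<delta> m / (2 * c * d) < d / c"
      proof -
        have "\<delta> m < 2 * (d * d)"
          using \<delta>(2)[of m] mult_mono[of 1 d 1 d] d by linarith
        then show ?thesis
          using c0 d by (simp add: field_simps)
      qed
      moreover have "0 < d / c" "0 < \<delta> m / (2 * c * d)" "x \<in> F"
        using x W(2) c0 d \<delta>(1)[of m] by auto
      ultimately have "card W \<le> covering_number (\<delta> m / (2 * c * d)) (cball x (d / c) \<inter> F)"
        and "real (covering_number (\<delta> m / (2 * c * d)) (cball x (d / c) \<inter> F))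
          \<le> C * (d / c / (\<delta> m / (2 * c * d))) powr s"
        using cov by blast+
      moreover have "d / c / (\<delta> m / (2 * c * d)) = 2 * d\<^sup>2 * (1 / \<delta> m)"
        using c0 d \<delta>(1)[of m] by (simp add: field_simps power2_eq_square)
      ultimately show ?thesis
        using W(4) Z(3) \<delta>(1)[of m] by (simp add: powr_mult powr_divide)
    qed
  qed (rule \<delta>(1))
qed

text \<open>
  If each ball centred in \<open>E\<close> contains \<open>\<theta> powr - t\<close> well separated balls of \<open>\<theta>\<close> times its
  radius, then \<open>E\<close> carries a tree that forces the \<open>t\<close>-cost of any finite cover of a ball of radius
  \<open>R\<close> to be at least \<open>(\<theta> / 2 * R) powr t\<close>. A covering ball of radius at least \<open>\<theta> / 2 * R\<close> pays
  this alone. Otherwise the covering balls are too small to meet two of the subballs, and the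
  costs for the subballs add up. The induction is on the number of levels between \<open>R\<close> and a lower
  bound \<open>\<delta>\<close> of all covering radii.
\<close>

lemma hausdorff_dim_ge_if_branching:
  fixes E :: "'a::metric_space set"
  assumes "compact E" and "e \<in> E" and "0 < \<rho>" and \<theta>: "0 < \<theta>" "\<theta> < 1" and t: "0 < t"
    and branch: "\<And>y R. y \<in> E \<Longrightarrow> dist e y \<le> \<rho> \<Longrightarrow> 0 < R \<Longrightarrow> R \<le> \<rho> \<Longrightarrow>
      \<exists>Y. finite Y \<and> Y \<subseteq> E \<inter> cball y ((1 - \<theta>) * R) \<and> separated_by (3 * \<theta> * R) Y \<and>
          (1 / \<theta>) powr t \<le> real (card Y)"
  shows "ereal t \<le> hausdorff_dim E"
proof -
  have content: "(\<theta> / 2 * R) powr t \<le> (\<Sum>(u, r)\<in>P. r powr t)"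
    if "finite P" "\<And>u r. (u, r) \<in> P \<Longrightarrow> \<delta> \<le> r" "0 < \<delta>" "y \<in> E" "0 < R" "dist e y + R \<le> \<rho>"
      "R * \<theta> ^ n \<le> \<delta>" "E \<inter> cball y R \<subseteq> (\<Union>(u, r)\<in>P. ball u r)" for n \<delta> y R and P :: "('a \<times> real) set"
    using that
  proof (induction n arbitrary: y R P)
    case 0
    have "y \<in> E \<inter> cball y R"
      using 0 by simp
    then obtain u r where ur: "(u, r) \<in> P"
      using "0.prems"(8) by auto
    have "\<theta> / 2 * R \<le> 1 * R"
      using \<theta> "0.prems"(5) by (intro mult_right_mono) auto
    also have "\<dots> \<le> r"
      using "0.prems"(2)[OF ur] "0.prems"(7) by simp
    finally have "(\<theta> / 2 * R) powr t \<le> r powr t"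
      using \<theta> "0.prems"(5) t by (intro powr_mono2) auto
    also have "\<dots> \<le> (\<Sum>(u, r)\<in>P. r powr t)"
      using member_le_sum[OF ur, of "\<lambda>(u, r). r powr t"] "0.prems"(1) by auto
    finally show ?case .
  next
    case (Suc n)
    show ?case
    proof (cases "\<exists>(u, r)\<in>P. \<theta> * R \<le> 2 * r")
      case True
      then obtain u r where ur: "(u, r) \<in> P" "\<theta> / 2 * R \<le> r"
        by auto
      then have "(\<theta> / 2 * R) powr t \<le> r powr t"
        using \<theta> Suc.prems(5) t by (intro powr_mono2) auto
      also have "\<dots> \<le> (\<Sum>(u, r)\<in>P. r powr t)"
        using member_le_sum[OF ur(1), of "\<lambda>(u, r). r powr t"] Suc.prems(1) by auto
      finally show ?thesis .
    next
      case False
      then have small: "2 * r < \<theta> * R" if "(u, r) \<in> P" for u r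
        using that by force
      have "dist e y \<le> \<rho>" "R \<le> \<rho>"
        using Suc.prems(5,6) zero_le_dist[of e y] by linarith+
      from branch[OF Suc.prems(4) this(1) Suc.prems(5) this(2)]
      obtain Y where Y: "finite Y" "Y \<subseteq> E \<inter> cball y ((1 - \<theta>) * R)"
        "separated_by (3 * \<theta> * R) Y" "(1 / \<theta>) powr t \<le> real (card Y)"
        by blast
      define Q where "Q z = {p \<in> P. ball (fst p) (snd p) \<inter> cball z (\<theta> * R) \<noteq> {}}" for z
      have QP: "Q z \<subseteq> P" for z
        by (auto simp: Q_def)
      have disj: "Q z \<inter> Q z' = {}" if z: "z \<in> Y" "z' \<in> Y" "z \<noteq> z'" for z z'
      proof (rule ccontr)
        assume "Q z \<inter> Q z' \<noteq> {}"
        then obtain u r w w' where p: "(u, r) \<in> P" "dist u w < r" "dist z w \<le> \<theta> * R"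
          "dist u w' < r" "dist z' w' \<le> \<theta> * R"
          by (fastforce simp: Q_def)
        have "dist z z' \<le> dist z w + dist u w + (dist u w' + dist z' w')"
          using dist_triangle[of z z' u] dist_triangle2[of z u w] dist_triangle2[of u z' w']
          by simp
        then show False
          using p small[OF p(1)] separated_byD[OF Y(3) z] by linarith
      qed
      have each: "(\<theta> / 2 * (\<theta> * R)) powr t \<le> (\<Sum>(u, r)\<in>Q z. r powr t)" if z: "z \<in> Y" for z
      proof (rule Suc.IH)
        have yz: "z \<in> E" "dist y z \<le> (1 - \<theta>) * R"
          using z Y(2) by auto
        show "finite (Q z)"
          using finite_subset[OF QP Suc.prems(1)] .
        show "\<delta> \<le> r" if "(u, r) \<in> Q z" for u r
          using that Suc.prems(2) QP by blast
        show "dist e z + \<theta> * R \<le> \<rho>"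
          using yz(2) dist_triangle[of e z y] Suc.prems(6) by (simp add: algebra_simps)
        show "\<theta> * R * \<theta> ^ n \<le> \<delta>"
          using Suc.prems(7) by (simp add: ac_simps)
        show "E \<inter> cball z (\<theta> * R) \<subseteq> (\<Union>(u, r)\<in>Q z. ball u r)"
        proof
          fix w assume w: "w \<in> E \<inter> cball z (\<theta> * R)"
          have "dist y w \<le> R"
            using w yz(2) dist_triangle[of y w z] by (simp add: algebra_simps)
          then obtain u r where ur: "(u, r) \<in> P" "w \<in> ball u r"
            using w Suc.prems(8) by force
          then have "(u, r) \<in> Q z"
            using w by (auto simp: Q_def)
          then show "w \<in> (\<Union>(u, r)\<in>Q z. ball u r)"
            using ur(2) by blast
        qed
      qed (use z Y(2) \<theta> Suc.prems(3,5) in auto)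
      have "(\<theta> / 2 * R) powr t = (1 / \<theta>) powr t * (\<theta> / 2 * (\<theta> * R)) powr t"
        using \<theta> Suc.prems(5) by (simp add: powr_mult powr_divide)
      also have "\<dots> \<le> real (card Y) * (\<theta> / 2 * (\<theta> * R)) powr t"
        by (intro mult_right_mono Y(4)) simp
      also have "\<dots> \<le> (\<Sum>z\<in>Y. \<Sum>(u, r)\<in>Q z. r powr t)"
        using sum_bounded_below[of Y "(\<theta> / 2 * (\<theta> * R)) powr t" "\<lambda>z. \<Sum>(u, r)\<in>Q z. r powr t"] each
        by simp
      also have "\<dots> = (\<Sum>(u, r)\<in>(\<Union>z\<in>Y. Q z). r powr t)"
        using Y(1) disj finite_subset[OF QP Suc.prems(1)]
        by (intro sum.UNION_disjoint[symmetric]) auto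
      also have "\<dots> \<le> (\<Sum>(u, r)\<in>P. r powr t)"
        using QP Suc.prems(1) by (intro sum_mono2) auto
      finally show ?thesis .
    qed
  qed
  show ?thesis
  proof (rule hausdorff_dim_ge_if_finite_covers[OF assms(1) t])
    show "0 < (\<theta> / 2 * \<rho>) powr t"
      using \<theta> assms(3) by simp
    show "(\<theta> / 2 * \<rho>) powr t \<le> (\<Sum>(u, r)\<in>P. r powr t)"
      if P: "finite P" "P \<subseteq> E \<times> {0<..}" "E \<subseteq> (\<Union>(u, r)\<in>P. ball u r)" for P
    proof -
      define \<delta> where "\<delta> = Min (snd ` P)"
      have "P \<noteq> {}"
        using P(3) assms(2) by auto
      then have "0 < \<delta>"
        using P(1,2) by (auto simp: \<delta>_def)
      moreover have "\<delta> \<le> r" if "(u, r) \<in> P" for u r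
        using P(1) that by (force simp: \<delta>_def intro!: Min_le)
      ultimately have \<delta>: "0 < \<delta>" "\<And>u r. (u, r) \<in> P \<Longrightarrow> \<delta> \<le> r"
        by blast+
      obtain n where "\<theta> ^ n < \<delta> / \<rho>"
        using real_arch_pow_inv[of "\<delta> / \<rho>" \<theta>] \<theta> \<delta>(1) assms(3) by auto
      then have "\<rho> * \<theta> ^ n \<le> \<delta>"
        using assms(3) by (simp add: field_simps)
      with \<delta> assms(2,3) P(1,3) show ?thesis
        by (intro content[of P \<delta> e \<rho> n]) auto
    qed
  qed
qed

text \<open>
  Near a point of \<open>E\<close> in the open cube, balls of a nearby miniset are complete similar copies of
  balls of \<open>F\<close>, not truncated by the boundary of the cube. The ratio being at least \<open>1\<close>,
  the balls of \<open>F\<close> have radius below \<open>1\<close>, where the lower dimension provides many separated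
  points. These move to \<open>E\<close>, which therefore has the branching property for each \<open>t < s\<close>.
\<close>

lemma lower_dim_le_hausdorff_dim_gallery:
  fixes F :: "(real ^ 'n) set"
  assumes "E \<in> gallery F"
  shows "lower_dim F \<le> hausdorff_dim E"
  unfolding lower_dim_def
proof (rule Sup_least, clarify)
  fix s C :: real
  assume s: "0 \<le> s" and C: "0 < C"
    and cov: "\<forall>R r. \<forall>x\<in>F. 0 < R \<and> R < 1 \<and> 0 < r \<and> r < R \<longrightarrow>
      C * (R / r) powr s \<le> real (covering_number r (cball x R \<inter> F))"
  have mic: "microset F E"
    using assms by (simp add: gallery_def)
  then have E: "E \<noteq> {}" "compact E"
    by (auto simp: microset_def unit_cube_compacts_def)
  obtain e where e: "e \<in> E" "e \<in> box 0 1"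
    using assms by (auto simp: gallery_def)
  obtain \<rho>0 where \<rho>0: "0 < \<rho>0" "cball e \<rho>0 \<subseteq> box 0 1"
    using open_contains_cball[of "box 0 (1 :: real ^ 'n)"] e(2) by auto
  define \<rho> where "\<rho> = min (\<rho>0 / 2) (1 / 2)"
  have \<rho>: "0 < \<rho>" "2 * \<rho> \<le> \<rho>0" "\<rho> < 1"
    using \<rho>0(1) by (auto simp: \<rho>_def)
  have main: "ereal t \<le> hausdorff_dim E" if t: "0 < t" "t < s" for t
  proof -
    \<comment> \<open>The gap between \<open>t\<close> and \<open>s\<close> absorbs the constant \<open>C\<close> and the losses of the
        construction as soon as \<open>\<theta>\<close> is small.\<close>
    define q where "q = (C / 16 powr s) powr (1 / (s - t))"
    define \<theta> where "\<theta> = min (1 / 32) q"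
    have \<theta>: "0 < \<theta>" "\<theta> \<le> 1 / 32" "\<theta> \<le> q"
      using C by (auto simp: \<theta>_def q_def)
    have "\<theta> powr (s - t) \<le> q powr (s - t)"
      using \<theta> t by (intro powr_mono2) auto
    also have "\<dots> = C / 16 powr s"
      using C t by (simp add: q_def powr_powr)
    finally have "\<theta> powr s / \<theta> powr t \<le> C / 16 powr s"
      by (simp add: powr_diff)
    then have count: "(1 / \<theta>) powr t \<le> C * (1 / (16 * \<theta>)) powr s"
      using \<theta> by (simp add: powr_divide powr_mult field_simps)
    show ?thesis
    proof (rule hausdorff_dim_ge_if_branching[OF E(2) e(1) \<rho>(1) \<theta>(1) _ t(1)])
      show "\<theta> < 1"
        using \<theta>(2) by simp
      fix y R assume y: "y \<in> E" "dist e y \<le> \<rho>" and R: "0 < R" "R \<le> \<rho>"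
      define \<eta> where "\<eta> = \<theta> * R / 4"
      have \<eta>: "0 < \<eta>" "\<eta> \<le> R / 128"
        using R \<theta> by (auto simp: \<eta>_def)
      obtain D c \<tau> where c: "1 \<le> c" and D: "D = (\<lambda>x. c *\<^sub>R x + \<tau>) ` F \<inter> cbox 0 1"
        "D \<noteq> {}" "bounded D" and close: "hausdorff_distance D E < \<eta>"
        using microset_close_miniset[OF mic \<eta>(1)] .
      have "hausdorff_distance E D < \<eta>"
        using close by (simp add: hausdorff_distance_commute)
      from hausdorff_distance_lessE[OF this compact_imp_bounded[OF E(2)] D(2) y(1)]
      obtain y' where y': "y' \<in> D" "dist y y' < \<eta>" .
      then obtain x where x: "x \<in> F" "y' = c *\<^sub>R x + \<tau>"
        using D(1) by blast
      define R' where "R' = R / c"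
      have R': "0 < R'" "R' < 1" "c * R' = R"
        using R \<rho>(3) c by (auto simp: R'_def field_simps)
      have "bounded (cball x (R' / 2) \<inter> F)"
        by (simp add: bounded_Int)
      then obtain Y where Y: "finite Y" "Y \<subseteq> cball x (R' / 2) \<inter> F"
        "separated_by (4 * \<theta> * R') Y" "cball x (R' / 2) \<inter> F \<subseteq> (\<Union>y\<in>Y. cball y (4 * \<theta> * R'))"
        using ex_separated_net[of "cball x (R' / 2) \<inter> F" "4 * \<theta> * R'"] \<theta>(1) R'(1) by auto
      have "(1 / \<theta>) powr t \<le> C * ((R' / 2) / (8 * \<theta> * R')) powr s"
        using count R'(1) by simp
      also have "\<dots> \<le> real (covering_number (8 * \<theta> * R') (cball x (R' / 2) \<inter> F))"
      proof -
        have "8 * \<theta> * R' < 1 / 2 * R'"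
          using \<theta> R'(1) by (intro mult_strict_right_mono) auto
        then have "0 < R' / 2 \<and> R' / 2 < 1 \<and> 0 < 8 * \<theta> * R' \<and> 8 * \<theta> * R' < R' / 2"
          using R' \<theta>(1) by simp
        then show ?thesis
          using cov x(1) by blast
      qed
      also have "\<dots> \<le> real (card Y)"
        using covering_number_le_balls[OF Y(1,4)] by simp
      finally have cardY: "(1 / \<theta>) powr t \<le> real (card Y)" .
      have c0: "0 < c"
        using c by simp
      let ?Y = "(\<lambda>x. c *\<^sub>R x + \<tau>) ` Y"
      have near: "dist y' z \<le> R / 2" if "z \<in> ?Y" for z
      proof -
        obtain w where w: "w \<in> Y" "z = c *\<^sub>R w + \<tau>"
          using \<open>z \<in> ?Y\<close> by blast
        then have "c * dist x w \<le> c * (R' / 2)"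
          using Y(2) c0 by (intro mult_left_mono) auto
        then show ?thesis
          using R'(3) unfolding x(2) w(2) dist_similarity[OF c0] by simp
      qed
      have sub: "?Y \<subseteq> D"
      proof
        fix z assume z: "z \<in> ?Y"
        have "dist e z \<le> dist e y + dist y y' + dist y' z"
          using dist_triangle[of e z y] dist_triangle[of y z y'] by linarith
        then have "dist e z \<le> \<rho>0"
          using near[OF z] y'(2) y(2) \<eta>(2) R \<rho>(2) by linarith
        then have "z \<in> cbox 0 1"
          using \<rho>0(2) box_subset_cbox[of 0 "1 :: real ^ 'n"] by auto
        then show "z \<in> D"
          using z Y(2) D(1) by blast
      qed
      have sep: "separated_by (4 * \<theta> * R) ?Y" and card: "card ?Y = card Y"
      proof -
        have "c * (4 * \<theta> * R') = 4 * \<theta> * R"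
          unfolding R'(3)[symmetric] by simp
        then show "separated_by (4 * \<theta> * R) ?Y" "card ?Y = card Y"
          using separated_image_similarity[OF Y(3) c0, of \<tau>] by (simp_all only:)
      qed
      have gap: "3 * \<theta> * R + 2 * \<eta> \<le> 4 * \<theta> * R" "0 \<le> 3 * \<theta> * R"
        using \<theta>(1) R(1) by (simp_all add: \<eta>_def)
      obtain Z where Z: "finite Z" "Z \<subseteq> E" "card Z = card ?Y"
        "separated_by (3 * \<theta> * R) Z" "\<And>z. z \<in> Z \<Longrightarrow> \<exists>w\<in>?Y. dist w z < \<eta>"
        by (rule separated_transfer[OF close D(3) E(1) finite_imageI[OF Y(1)] sub sep gap]) blast
      have "Z \<subseteq> cball y ((1 - \<theta>) * R)"
      proof
        fix z assume "z \<in> Z"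
        then obtain w where w: "w \<in> ?Y" "dist w z < \<eta>"
          using Z(5) by blast
        have "dist y z \<le> dist y y' + dist y' w + dist w z"
          using dist_triangle[of y z y'] dist_triangle[of y' z w] by linarith
        then have "dist y z \<le> R / 2 + R / 64"
          using near[OF w(1)] w(2) y'(2) \<eta>(2) by linarith
        moreover have "\<theta> * R \<le> 1 / 32 * R"
          using \<theta>(2) R(1) by (intro mult_right_mono) auto
        ultimately have "dist y z \<le> R - \<theta> * R"
          using R(1) by linarith
        then show "z \<in> cball y ((1 - \<theta>) * R)"
          by (simp add: algebra_simps)
      qed
      then show "\<exists>Y. finite Y \<and> Y \<subseteq> E \<inter> cball y ((1 - \<theta>) * R) \<and> separated_by (3 * \<theta> * R) Y \<and>
          (1 / \<theta>) powr t \<le> real (card Y)"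
        using Z(1-4) card cardY by (intro exI[of _ Z]) auto
    qed
  qed
  show "ereal s \<le> hausdorff_dim E"
  proof (rule ereal_le_epsilon2)
    fix \<epsilon> :: real assume \<epsilon>: "0 < \<epsilon>"
    show "ereal s \<le> hausdorff_dim E + ereal \<epsilon>"
    proof (cases "0 < s - \<epsilon>")
      case True
      then have "ereal (s - \<epsilon>) + ereal \<epsilon> \<le> hausdorff_dim E + ereal \<epsilon>"
        using main[of "s - \<epsilon>"] \<epsilon> by (intro add_right_mono) auto
      then show ?thesis
        by simp
    next
      case False
      then have "ereal s \<le> 0 + ereal \<epsilon>"
        by simp
      also have "\<dots> \<le> hausdorff_dim E + ereal \<epsilon>"
        by (intro add_right_mono hausdorff_dim_nonneg)
      finally show ?thesis .
    qed
  qed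
qed

section \<open>Iterating one-step estimates\<close>

lemma dyadic_bracket:
  obtains k :: nat where "k = 0 \<or> 2 ^ k \<le> u" "(u :: real) < 2 ^ Suc k"
proof -
  obtain n where "u < 2 ^ n"
    using real_arch_pow[of 2 u] by auto
  also have "(2 :: real) ^ n \<le> 2 ^ Suc n"
    by simp
  finally have "\<exists>n. u < 2 ^ Suc n"
    by blast
  then have less: "u < 2 ^ Suc (LEAST n. u < 2 ^ Suc n)"
    by (rule LeastI_ex)
  have "(LEAST n. u < 2 ^ Suc n) = 0 \<or> 2 ^ (LEAST n. u < 2 ^ Suc n) \<le> u"
  proof (cases "LEAST n. u < 2 ^ Suc n")
    case (Suc j)
    then have "\<not> u < 2 ^ Suc j"
      using not_less_Least[of j "\<lambda>n. u < 2 ^ Suc n"] by simp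
    then show ?thesis
      using Suc by simp
  qed simp
  then show ?thesis
    using that less by blast
qed

text \<open>
  Each ball may use its own number \<open>m\<close> of dyadic levels. Descending from a ball through good
  steps until \<open>k\<close> levels are nearly exhausted, the numbers of points multiply to at least
  \<open>2 powr (t * (k - L))\<close>; stopping up to \<open>L\<close> levels early costs the constant factor
  \<open>2 powr (- t * L)\<close>. The factor \<open>3\<close> in the separation keeps different subballs apart.
\<close>

lemma lower_dim_ge_if_branching:
  fixes F :: "(real ^ 'n) set"
  assumes t: "0 \<le> t"
    and branch: "\<And>y \<rho>. y \<in> F \<Longrightarrow> 0 < \<rho> \<Longrightarrow> \<rho> < 1 \<Longrightarrow>
      \<exists>m Y. 1 \<le> m \<and> m \<le> L \<and> finite Y \<and> Y \<subseteq> F \<inter> cball y (\<rho> / 2) \<and>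
        separated_by (3 * \<rho> / 2 ^ m) Y \<and> 2 powr (t * real m) \<le> real (card Y)"
  shows "ereal t \<le> lower_dim F"
proof -
  have tree: "\<exists>Z. finite Z \<and> Z \<subseteq> F \<inter> cball y \<rho> \<and> separated_by (\<rho> / 2 ^ k) Z \<and>
      2 powr (t * (real k - real L)) \<le> real (card Z)"
    if "y \<in> F" "0 < \<rho>" "\<rho> < 1" for k y \<rho>
    using that
  proof (induction k arbitrary: y \<rho> rule: less_induct)
    case (less k)
    show ?case
    proof (cases "k \<le> L")
      case True
      then have "t * (real k - real L) \<le> 0"
        using t by (simp add: mult_nonneg_nonpos)
      then have "2 powr (t * (real k - real L)) \<le> 2 powr 0"
        by (intro powr_mono) auto
      then show ?thesis
        using less.prems by (intro exI[of _ "{y}"]) (simp add: separated_by_def)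
    next
      case False
      obtain m Y where m: "1 \<le> m" "m \<le> L" and Y: "finite Y" "Y \<subseteq> F \<inter> cball y (\<rho> / 2)"
        "separated_by (3 * \<rho> / 2 ^ m) Y" "2 powr (t * real m) \<le> real (card Y)"
        using branch[OF less.prems] by blast
      have half: "\<rho> / 2 ^ m \<le> \<rho> / 2"
        using m(1) less.prems(2) power_increasing[OF m(1), of "2::real"]
        by (intro divide_left_mono) auto
      have sub: "0 < \<rho> / 2 ^ m" "\<rho> / 2 ^ m < 1"
        using half less.prems(2,3) by (simp, linarith)
      have "\<exists>Z. finite Z \<and> Z \<subseteq> F \<inter> cball z (\<rho> / 2 ^ m) \<and> separated_by (\<rho> / 2 ^ m / 2 ^ (k - m)) Z \<and>
          2 powr (t * (real (k - m) - real L)) \<le> real (card Z)" if "z \<in> Y" for z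
        using less.IH[of "k - m" z "\<rho> / 2 ^ m"] m False that Y(2) sub by auto
      then obtain Z where Z: "\<And>z. z \<in> Y \<Longrightarrow> finite (Z z)"
        "\<And>z. z \<in> Y \<Longrightarrow> Z z \<subseteq> F \<inter> cball z (\<rho> / 2 ^ m)"
        "\<And>z. z \<in> Y \<Longrightarrow> separated_by (\<rho> / 2 ^ m / 2 ^ (k - m)) (Z z)"
        "\<And>z. z \<in> Y \<Longrightarrow> 2 powr (t * (real (k - m) - real L)) \<le> real (card (Z z))"
        by metis
      have km: "\<rho> / 2 ^ m / 2 ^ (k - m) = \<rho> / 2 ^ k"
        using m False by (simp flip: power_add)
      have cross: "\<rho> / 2 ^ k < dist w w'"
        if z: "z \<in> Y" "z' \<in> Y" "z \<noteq> z'" and w: "w \<in> Z z" "w' \<in> Z z'" for z z' w w'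
      proof -
        have "dist z w \<le> \<rho> / 2 ^ m" "dist z' w' \<le> \<rho> / 2 ^ m"
          using Z(2)[OF z(1)] Z(2)[OF z(2)] w by auto
        moreover have "dist z z' \<le> dist z w + dist w w' + dist z' w'"
          using dist_triangle[of z z' w] dist_triangle2[of w z' w'] by simp
        moreover have "3 * \<rho> / 2 ^ m < dist z z'"
          by (rule separated_byD[OF Y(3) z])
        moreover have "\<rho> / 2 ^ k \<le> \<rho> / 2 ^ m"
          using m False less.prems(2) by (intro divide_left_mono power_increasing) auto
        moreover have "3 * \<rho> / 2 ^ m = 3 * (\<rho> / 2 ^ m)"
          by simp
        ultimately show ?thesis
          by linarith
      qed
      let ?W = "\<Union>z\<in>Y. Z z"
      have "?W \<subseteq> F \<inter> cball y \<rho>"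
      proof
        fix w assume "w \<in> ?W"
        then obtain z where z: "z \<in> Y" "w \<in> Z z"
          by blast
        then have "dist y z \<le> \<rho> / 2" "dist z w \<le> \<rho> / 2 ^ m" "w \<in> F"
          using Y(2) Z(2)[OF z(1)] by auto
        then have "dist y w \<le> \<rho>" "w \<in> F"
          using half dist_triangle[of y w z] by linarith+
        then show "w \<in> F \<inter> cball y \<rho>"
          by simp
      qed
      moreover have "separated_by (\<rho> / 2 ^ k) ?W"
      proof (rule separated_byI)
        fix w w' assume "w \<in> ?W" "w' \<in> ?W" "w \<noteq> w'"
        then obtain z z' where z: "z \<in> Y" "z' \<in> Y" "w \<in> Z z" "w' \<in> Z z'"
          by blast
        show "\<rho> / 2 ^ k < dist w w'"
        proof (cases "z = z'")
          case True
          then show ?thesis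
            using separated_byD[OF Z(3)[OF z(1)] z(3), of w'] z(4) \<open>w \<noteq> w'\<close> unfolding km by simp
        next
          case False
          then show ?thesis
            using cross z by blast
        qed
      qed
      moreover have "2 powr (t * (real k - real L)) \<le> real (card ?W)"
      proof -
        have disj: "Z z \<inter> Z z' = {}" if "z \<in> Y" "z' \<in> Y" "z \<noteq> z'" for z z'
        proof (rule ccontr)
          assume "Z z \<inter> Z z' \<noteq> {}"
          then obtain w where "w \<in> Z z" "w \<in> Z z'"
            by blast
          then have "\<rho> / 2 ^ k < dist w w"
            by (rule cross[OF that])
          moreover have "0 < \<rho> / 2 ^ k"
            using less.prems(2) by simp
          ultimately show False
            by simp
        qed
        have "2 powr (t * (real k - real L)) =
            2 powr (t * real m) * 2 powr (t * (real (k - m) - real L))"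
          using m False by (simp add: of_nat_diff algebra_simps flip: powr_add)
        also have "\<dots> \<le> real (card Y) * 2 powr (t * (real (k - m) - real L))"
          by (intro mult_right_mono Y(4)) simp
        also have "\<dots> \<le> (\<Sum>z\<in>Y. real (card (Z z)))"
          using sum_bounded_below[of Y "2 powr (t * (real (k - m) - real L))" "\<lambda>z. real (card (Z z))"]
            Z(4) by simp
        also have "\<dots> = real (card ?W)"
          using card_UN_disjoint[of Y Z] Y(1) Z(1) disj by simp
        finally show ?thesis .
      qed
      moreover have "finite ?W"
        using Y(1) Z(1) by blast
      ultimately show ?thesis
        by blast
    qed
  qed
  define d where "d = real CARD('n)"
  have d: "1 \<le> d"
    by (simp add: d_def Suc_leI)
  define C where "C = 2 powr (- t * real L) * (1 / (2 * d)) powr t"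
  have "C * (R / r) powr t \<le> real (covering_number r (cball x R \<inter> F))"
    if x: "x \<in> F" and Rr: "0 < R" "R < 1" "0 < r" "r < R" for R r x
  proof -
    define u where "u = R / (d * r)"
    have u: "0 < u"
      using Rr d by (simp add: u_def)
    obtain k where k: "k = 0 \<or> 2 ^ k \<le> u" "u < 2 ^ Suc k"
      by (rule dyadic_bracket)
    have bnd: "bounded (cball x R \<inter> F)"
      by (simp add: bounded_Int)
    have "C * (R / r) powr t = 2 powr (- t * real L) * (u / 2) powr t"
      using Rr d by (simp add: C_def u_def powr_mult powr_divide)
    also have "\<dots> \<le> 2 powr (- t * real L) * (2 ^ k) powr t"
      using k(2) u t by (intro mult_left_mono powr_mono2) auto
    also have "\<dots> = 2 powr (t * (real k - real L))"
      by (simp add: powr_powr algebra_simps flip: powr_realpow powr_add)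
    also have "\<dots> \<le> real (covering_number r (cball x R \<inter> F))"
    proof (cases "2 ^ k \<le> u")
      case True
      obtain Z where Z: "Z \<subseteq> F \<inter> cball x R" "separated_by (R / 2 ^ k) Z"
        "2 powr (t * (real k - real L)) \<le> real (card Z)"
        using tree[OF x Rr(1,2), of k] by blast
      have "d * r \<le> R / 2 ^ k"
        using True Rr d by (simp add: u_def field_simps)
      then have "separated_by (real CARD('n) * r) Z"
        using separated_by_mono[OF Z(2)] by (simp add: d_def)
      then have "card Z \<le> covering_number r (cball x R \<inter> F)"
        using Z(1) by (intro separated_card_le_covering_number bnd Rr) auto
      then show ?thesis
        using Z(3) by linarith
    next
      case False
      then have "2 powr (t * (real k - real L)) \<le> 2 powr 0"
        using k(1) t by (intro powr_mono) auto
      moreover have "x \<in> cball x R \<inter> F"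
        using x Rr(1) by simp
      then have "1 \<le> covering_number r (cball x R \<inter> F)"
        by (intro covering_number_ge_1 bnd Rr) blast
      ultimately show ?thesis
        by simp
    qed
    finally show ?thesis .
  qed
  moreover have "0 < C"
    using d by (simp add: C_def)
  ultimately show ?thesis
    unfolding lower_dim_def using t by (intro Sup_upper) blast
qed

text \<open>
  Substituting covers into covers, a sum of relative costs at most \<open>1\<close> stays at most \<open>1\<close>. After
  \<open>k\<close> levels all balls have radius between \<open>\<rho> / 2 ^ k\<close> and \<open>2 ^ L\<close> times that. Each then costs
  at least \<open>2 powr (- t * k)\<close>, so there are at most \<open>2 powr (t * k)\<close> of them. The
  hypothesis concerns small radii only; for larger balls one starts from a fixed finite cover
  of \<open>F\<close>.
\<close>

lemma assouad_dim_le_if_efficient_covers: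
  fixes F :: "(real ^ 'n) set"
  assumes "compact F" and t: "0 \<le> t"
    and cover: "\<And>x \<rho>. x \<in> F \<Longrightarrow> 0 < \<rho> \<Longrightarrow> \<rho> \<le> 1 / 4 \<Longrightarrow>
      \<exists>P. finite P \<and> P \<subseteq> F \<times> {1..L} \<and> F \<inter> cball x \<rho> \<subseteq> (\<Union>(u, m)\<in>P. cball u (\<rho> / 2 ^ m)) \<and>
        (\<Sum>(u, m)\<in>P. 2 powr (- t * real m)) \<le> 1"
  shows "assouad_dim F \<le> ereal t"
proof -
  have tree: "\<exists>Q. finite Q \<and> F \<inter> cball x \<rho> \<subseteq> (\<Union>q\<in>Q. cball q (\<rho> * 2 ^ L / 2 ^ k)) \<and>
      real (card Q) \<le> 2 powr (t * real k)"
    if "x \<in> F" "0 < \<rho>" "\<rho> \<le> 1 / 4" for k x \<rho>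
    using that
  proof (induction k arbitrary: x \<rho> rule: less_induct)
    case (less k)
    show ?case
    proof (cases "k \<le> L")
      case True
      have "\<rho> * 2 ^ k \<le> \<rho> * 2 ^ L"
        using True less.prems(2) by (intro mult_left_mono power_increasing) auto
      then have "cball x \<rho> \<subseteq> cball x (\<rho> * 2 ^ L / 2 ^ k)"
        by (intro subset_cball) (simp add: field_simps)
      moreover have "2 powr 0 \<le> 2 powr (t * real k)"
        using t by (intro powr_mono) auto
      ultimately show ?thesis
        by (intro exI[of _ "{x}"]) auto
    next
      case False
      obtain P where P: "finite P" "P \<subseteq> F \<times> {1..L}"
        "F \<inter> cball x \<rho> \<subseteq> (\<Union>(u, m)\<in>P. cball u (\<rho> / 2 ^ m))"
        "(\<Sum>(u, m)\<in>P. 2 powr (- t * real m)) \<le> 1"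
        using cover[OF less.prems] by blast
      have "\<exists>Q. finite Q \<and> F \<inter> cball (fst p) (\<rho> / 2 ^ snd p) \<subseteq> (\<Union>q\<in>Q. cball q (\<rho> * 2 ^ L / 2 ^ k)) \<and>
          real (card Q) \<le> 2 powr (t * real k) * 2 powr (- t * real (snd p))" if "p \<in> P" for p
      proof -
        obtain u m where p: "p = (u, m)"
          by (cases p)
        have um: "u \<in> F" "1 \<le> m" "m \<le> L"
          using that P(2) p by auto
        have "\<rho> / 2 ^ m \<le> \<rho> / 1"
          using less.prems(2) by (intro divide_left_mono) auto
        then have "\<rho> / 2 ^ m \<le> 1 / 4"
          using less.prems(3) by linarith
        then obtain Q where "finite Q"
          "F \<inter> cball u (\<rho> / 2 ^ m) \<subseteq> (\<Union>q\<in>Q. cball q (\<rho> / 2 ^ m * 2 ^ L / 2 ^ (k - m)))"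
          "real (card Q) \<le> 2 powr (t * real (k - m))"
          using less.IH[of "k - m" u "\<rho> / 2 ^ m"] um False less.prems(2) by auto
        moreover have "\<rho> / 2 ^ m * 2 ^ L / 2 ^ (k - m) = \<rho> * 2 ^ L / 2 ^ k"
          using um False by (simp flip: power_add)
        moreover have "2 powr (t * real (k - m)) = 2 powr (t * real k) * 2 powr (- t * real m)"
          using um False by (simp add: of_nat_diff algebra_simps flip: powr_add)
        ultimately show ?thesis
          unfolding p by (intro exI[of _ Q] conjI) (simp_all only: fst_conv snd_conv)
      qed
      then obtain Q where Q: "\<And>p. p \<in> P \<Longrightarrow> finite (Q p)"
        "\<And>p. p \<in> P \<Longrightarrow> F \<inter> cball (fst p) (\<rho> / 2 ^ snd p) \<subseteq> (\<Union>q\<in>Q p. cball q (\<rho> * 2 ^ L / 2 ^ k))"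
        "\<And>p. p \<in> P \<Longrightarrow> real (card (Q p)) \<le> 2 powr (t * real k) * 2 powr (- t * real (snd p))"
        by metis
      let ?W = "\<Union>p\<in>P. Q p"
      have "F \<inter> cball x \<rho> \<subseteq> (\<Union>q\<in>?W. cball q (\<rho> * 2 ^ L / 2 ^ k))"
      proof
        fix w assume w: "w \<in> F \<inter> cball x \<rho>"
        then obtain p where p: "p \<in> P" "w \<in> F \<inter> cball (fst p) (\<rho> / 2 ^ snd p)"
          using P(3) by fastforce
        then show "w \<in> (\<Union>q\<in>?W. cball q (\<rho> * 2 ^ L / 2 ^ k))"
          using Q(2)[OF p(1)] by blast
      qed
      moreover have "real (card ?W) \<le> 2 powr (t * real k)"
      proof -
        have "real (card ?W) \<le> (\<Sum>p\<in>P. real (card (Q p)))"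
          using card_UN_le[OF P(1), of Q] by (simp flip: of_nat_sum)
        also have "\<dots> \<le> (\<Sum>p\<in>P. 2 powr (t * real k) * 2 powr (- t * real (snd p)))"
          by (intro sum_mono Q(3))
        also have "\<dots> = 2 powr (t * real k) * (\<Sum>(u, m)\<in>P. 2 powr (- t * real m))"
          by (simp add: sum_distrib_left case_prod_beta)
        also have "\<dots> \<le> 2 powr (t * real k) * 1"
          by (intro mult_left_mono P(4)) simp
        finally show ?thesis
          by simp
      qed
      moreover have "finite ?W"
        using P(1) Q(1) by blast
      ultimately show ?thesis
        by blast
    qed
  qed
  obtain T where T: "finite T" "T \<subseteq> F" "F \<subseteq> (\<Union>x\<in>T. cball x (1 / 4))"
    using ex_separated_net[OF compact_imp_bounded[OF assms(1)], of "1 / 4"]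
    by (metis zero_less_divide_1_iff zero_less_numeral)
  define C where "C = real (Suc (card T)) * (4 * 2 ^ L) powr t"
  have "real (covering_number r (cball x R \<inter> F)) \<le> C * (R / r) powr t"
    if x: "x \<in> F" and Rr: "0 < R" "0 < r" "r < R" for R r x
  proof -
    have "\<exists>S \<rho>. finite S \<and> S \<subseteq> F \<and> card S \<le> Suc (card T) \<and> 0 < \<rho> \<and> \<rho> \<le> R \<and> \<rho> \<le> 1 / 4 \<and>
        cball x R \<inter> F \<subseteq> (\<Union>s\<in>S. F \<inter> cball s \<rho>)"
    proof (cases "R \<le> 1 / 4")
      case True
      then show ?thesis
        using x Rr by (intro exI[of _ "{x}"] exI[of _ R]) auto
    next
      case False
      then show ?thesis
        using T by (intro exI[of _ T] exI[of _ "1 / 4"]) auto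
    qed
    then obtain S \<rho> where S: "finite S" "S \<subseteq> F" "card S \<le> Suc (card T)"
      "cball x R \<inter> F \<subseteq> (\<Union>s\<in>S. F \<inter> cball s \<rho>)" and \<rho>: "0 < \<rho>" "\<rho> \<le> R" "\<rho> \<le> 1 / 4"
      by blast
    define u where "u = 2 ^ Suc L * R / r"
    have "1 * r \<le> 2 ^ Suc L * R"
      using Rr one_le_power[of "2 :: real" "Suc L"] by (intro mult_mono) auto
    then have u: "1 \<le> u"
      using Rr by (simp add: u_def field_simps)
    obtain j where j: "j = 0 \<or> 2 ^ j \<le> u" "u < 2 ^ Suc j"
      by (rule dyadic_bracket)
    define k where "k = Suc j"
    have k: "u \<le> 2 ^ k" "2 ^ k \<le> 2 * u"
      using j u by (auto simp: k_def)
    have "\<exists>Q. finite Q \<and> F \<inter> cball s \<rho> \<subseteq> (\<Union>q\<in>Q. cball q (\<rho> * 2 ^ L / 2 ^ k)) \<and>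
        real (card Q) \<le> 2 powr (t * real k)" if "s \<in> S" for s
      using tree[of s \<rho> k] that S(2) \<rho> by blast
    then obtain Q where Q: "\<And>s. s \<in> S \<Longrightarrow> finite (Q s)"
      "\<And>s. s \<in> S \<Longrightarrow> F \<inter> cball s \<rho> \<subseteq> (\<Union>q\<in>Q s. cball q (\<rho> * 2 ^ L / 2 ^ k))"
      "\<And>s. s \<in> S \<Longrightarrow> real (card (Q s)) \<le> 2 powr (t * real k)"
      by metis
    let ?W = "\<Union>s\<in>S. Q s"
    have "covering_number r (cball x R \<inter> F) \<le> card ?W"
    proof (rule covering_number_le_balls)
      show "finite ?W"
        using S(1) Q(1) by blast
      show "cball x R \<inter> F \<subseteq> (\<Union>q\<in>?W. cball q (\<rho> * 2 ^ L / 2 ^ k))"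
        using S(4) Q(2) by fastforce
      have "2 * (\<rho> * 2 ^ L) \<le> 2 ^ Suc L * R"
        using \<rho>(2) by simp
      also have "\<dots> = r * u"
        using Rr by (simp add: u_def)
      also have "\<dots> \<le> r * 2 ^ k"
        using Rr k(1) by (intro mult_left_mono) auto
      finally show "2 * (\<rho> * 2 ^ L / 2 ^ k) \<le> r"
        by (simp add: field_simps)
    qed
    also have "\<dots> \<le> (\<Sum>s\<in>S. card (Q s))"
      by (rule card_UN_le[OF S(1)])
    finally have "real (covering_number r (cball x R \<inter> F)) \<le> (\<Sum>s\<in>S. real (card (Q s)))"
      by (simp flip: of_nat_sum)
    also have "\<dots> \<le> real (card S) * 2 powr (t * real k)"
      using sum_bounded_above[of S "\<lambda>s. real (card (Q s))"] Q(3) by simp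
    also have "2 powr (t * real k) = (2 ^ k) powr t"
      by (simp add: powr_powr ac_simps flip: powr_realpow)
    also have "real (card S) * (2 ^ k) powr t \<le> real (Suc (card T)) * (2 * u) powr t"
      using S(3) k(2) t by (intro mult_mono powr_mono2) auto
    also have "(2 * u) powr t = (4 * 2 ^ L) powr t * (R / r) powr t"
      using Rr by (simp add: u_def mult.assoc flip: powr_mult)
    finally show ?thesis
      by (simp add: C_def)
  qed
  moreover have "0 < C"
    by (simp add: C_def)
  ultimately show ?thesis
    unfolding assouad_dim_def using t by (intro Inf_lower) blast
qed

section \<open>Gallery elements obtained from atypical balls\<close>

lemma dist_centre_le:
  fixes x :: "real ^ 'n"
  assumes "x \<in> cbox 0 1"
  shows "dist ((1 / 2) *\<^sub>R 1) x \<le> real CARD('n) / 2"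
proof -
  have "\<bar>((1 / 2) *\<^sub>R 1 - x) $ i\<bar> \<le> 1 / 2" for i
    using assms by (simp add: mem_box_cart abs_le_iff) (smt (verit, best) field_sum_of_halves)
  then have "(\<Sum>i\<in>UNIV. \<bar>((1 / 2) *\<^sub>R 1 - x) $ i\<bar>) \<le> real CARD('n) / 2"
    using sum_bounded_above[of UNIV "\<lambda>i. \<bar>((1 / 2) *\<^sub>R 1 - x) $ i\<bar>" "1 / 2"] by simp
  then show ?thesis
    using norm_le_l1_cart[of "(1 / 2) *\<^sub>R 1 - x"] by (simp add: dist_norm)
qed

lemma centre_cball_subset_cube: "cball ((1 / 2) *\<^sub>R 1) (1 / 4) \<subseteq> cbox 0 (1 :: real ^ 'n)"
proof
  fix x :: "real ^ 'n" assume "x \<in> cball ((1 / 2) *\<^sub>R 1) (1 / 4)"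
  then have "\<bar>((1 / 2) *\<^sub>R 1 - x) $ i\<bar> \<le> 1 / 4" for i
    using component_le_norm_cart[of "(1 / 2) *\<^sub>R 1 - x" i] by (simp add: dist_norm)
  then have near: "\<bar>1 / 2 - x $ i\<bar> \<le> 1 / 4" for i
    by simp
  have "0 \<le> x $ i \<and> x $ i \<le> 1" for i
    using near[of i] by linarith
  then show "x \<in> cbox 0 1"
    by (simp add: mem_box_cart)
qed

text \<open>
  Since \<open>lower_dim F < t\<close>, branching must fail for every \<open>L\<close>: some ball of \<open>F\<close> has fewer than
  \<open>2 powr (t * m)\<close> separated points at each of its first \<open>L\<close> dyadic scales. Zooming in on
  these balls and letting \<open>L\<close> tend to infinity gives a microset that is sparse at all scales.
\<close>

lemma ex_gallery_hausdorff_dim_le: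
  fixes F :: "(real ^ 'n) set"
  assumes "compact F" and t: "0 \<le> t" and "lower_dim F < ereal t"
  shows "\<exists>E\<in>gallery F. hausdorff_dim E \<le> ereal t"
proof -
  have "\<exists>y \<rho>. y \<in> F \<and> 0 < \<rho> \<and> \<rho> < 1 \<and> (\<forall>m Y. 1 \<le> m \<and> m \<le> L \<and> finite Y \<and>
      Y \<subseteq> F \<inter> cball y (\<rho> / 2) \<and> separated_by (3 * \<rho> / 2 ^ m) Y \<longrightarrow>
      real (card Y) < 2 powr (t * real m))" for L :: nat
  proof (rule ccontr)
    assume "\<not> ?thesis"
    then have "ereal t \<le> lower_dim F"
      by (intro lower_dim_ge_if_branching[OF t, of F L]) (metis not_less)
    then show False
      using assms(3) by simp
  qed
  then obtain y \<rho> where y: "\<And>L. y L \<in> F" and \<rho>: "\<And>L. 0 < \<rho> L" "\<And>L. \<rho> L < 1"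
    and sparse: "\<And>L m Y. 1 \<le> m \<Longrightarrow> m \<le> L \<Longrightarrow> finite Y \<Longrightarrow> Y \<subseteq> F \<inter> cball (y L) (\<rho> L / 2) \<Longrightarrow>
      separated_by (3 * \<rho> L / 2 ^ m) Y \<Longrightarrow> real (card Y) < 2 powr (t * real m)"
    by metis
  define d where "d = real CARD('n)"
  have d: "1 \<le> d"
    by (simp add: d_def Suc_leI)
  \<comment> \<open>With this ratio the preimage of the unit cube lies in the ball of radius \<open>\<rho> L / 2\<close> around \<open>y L\<close>.\<close>
  define c where "c L = d / \<rho> L" for L
  have c: "1 \<le> c L" for L
    using \<rho>[of L] d by (simp add: c_def)
  obtain E \<sigma> where \<sigma>: "strict_mono (\<sigma> :: nat \<Rightarrow> nat)" and gal: "E \<in> gallery F"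
    and lim: "(\<lambda>k. hausdorff_distance (zoom F (y (\<sigma> k)) (c (\<sigma> k))) E) \<longlonglongrightarrow> 0"
    by (rule zoom_limit[OF assms(1) y c])
  have E: "E \<noteq> {}" "compact E"
    using gal by (auto simp: gallery_def microset_def unit_cube_compacts_def)
  define \<delta> where "\<delta> m = 4 * d / 2 ^ Suc m" for m
  have \<delta>: "0 < \<delta> m" for m
    using d by (simp add: \<delta>_def)
  have "hausdorff_dim E \<le> ereal t"
  proof (rule hausdorff_dim_le_if_separated_bound[OF compact_imp_bounded[OF E(2)] t])
    have "(\<lambda>m. 2 * d * (1 / 2) ^ m) \<longlonglongrightarrow> 2 * d * 0"
      by (intro tendsto_mult tendsto_const LIMSEQ_realpow_zero) auto
    moreover have "\<delta> = (\<lambda>m. 2 * d * (1 / 2) ^ m)"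
      by (simp add: \<delta>_def power_divide fun_eq_iff)
    ultimately show "\<delta> \<longlonglongrightarrow> 0"
      by simp
    show "real (card Y) \<le> (4 * d) powr t * (1 / \<delta> m) powr t"
      if Y: "finite Y" "Y \<subseteq> E" "separated_by (\<delta> m) Y" for m Y
    proof -
      define M where "M = Suc m"
      have "0 < d / 2 ^ M / 2"
        using d by simp
      then have "eventually (\<lambda>j. hausdorff_distance (zoom F (y (\<sigma> j)) (c (\<sigma> j))) E < d / 2 ^ M / 2 \<and>
          M \<le> j) sequentially"
        by (intro eventually_conj order_tendstoD(2)[OF lim] eventually_ge_at_top)
      then obtain j where j: "hausdorff_distance (zoom F (y (\<sigma> j)) (c (\<sigma> j))) E < d / 2 ^ M / 2" "M \<le> j"
        using eventually_happens'[OF sequentially_bot] by blast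
      define L where "L = \<sigma> j"
      have L: "M \<le> L"
        using j(2) seq_suble[OF \<sigma>, of j] by (simp add: L_def)
      let ?D = "zoom F (y L) (c L)"
      have D: "?D \<noteq> {}"
        using zoom_props(2)[OF assms(1) y c] by blast
      have "hausdorff_distance E ?D < d / 2 ^ M / 2"
        using j(1) by (simp add: L_def hausdorff_distance_commute)
      moreover have "3 * d / 2 ^ M + 2 * (d / 2 ^ M / 2) \<le> \<delta> m" "0 \<le> 3 * d / 2 ^ M"
        using d by (simp_all add: \<delta>_def M_def)
      ultimately obtain Z where Z: "finite Z" "Z \<subseteq> ?D" "card Z = card Y"
        "separated_by (3 * d / 2 ^ M) Z"
        using separated_transfer[OF _ compact_imp_bounded[OF E(2)] D Y] by metis
      have c0: "0 < c L"
        using c[of L] by simp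
      have "Z \<subseteq> (\<lambda>x. c L *\<^sub>R x + ((1 / 2) *\<^sub>R 1 - c L *\<^sub>R y L)) ` F"
        using Z(2) by (simp add: zoom_def)
      then obtain W where W: "finite W" "W \<subseteq> F"
        "Z = (\<lambda>x. c L *\<^sub>R x + ((1 / 2) *\<^sub>R 1 - c L *\<^sub>R y L)) ` W"
        "card W = card Z" "separated_by (3 * d / 2 ^ M / c L) W"
        by (rule separated_preimage_similarity[OF Z(4) c0 Z(1)])
      have "W \<subseteq> F \<inter> cball (y L) (\<rho> L / 2)"
      proof
        fix w assume w: "w \<in> W"
        let ?w = "c L *\<^sub>R w + ((1 / 2) *\<^sub>R 1 - c L *\<^sub>R y L)"
        have "?w \<in> cbox 0 1"
          using w W(3) Z(2) by (auto simp: zoom_def)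
        from dist_centre_le[OF this]
        have "dist (c L *\<^sub>R y L + ((1 / 2) *\<^sub>R 1 - c L *\<^sub>R y L)) ?w \<le> d / 2"
          by (simp add: d_def)
        then have "c L * dist (y L) w \<le> d / 2"
          by (simp only: dist_similarity[OF c0])
        then show "w \<in> F \<inter> cball (y L) (\<rho> L / 2)"
          using w W(2) \<rho>(1)[of L] d by (auto simp: c_def field_simps)
      qed
      moreover have "3 * d / 2 ^ M / c L = 3 * \<rho> L / 2 ^ M"
        using \<rho>(1)[of L] d by (simp add: c_def)
      ultimately have "real (card W) < 2 powr (t * real M)"
        using sparse[of M L W] W(1,5) L by (simp add: M_def)
      also have "\<dots> = (2 ^ M) powr t"
        by (simp add: powr_powr ac_simps flip: powr_realpow)
      also have "2 ^ M = 4 * d * (1 / \<delta> m)"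
        using d by (simp add: \<delta>_def M_def)
      finally show ?thesis
        using W(4) Z(3) d \<delta>[of m] by (simp add: powr_mult powr_divide)
    qed
  qed (rule \<delta>)
  then show ?thesis
    using gal by blast
qed

text \<open>
  Since \<open>t < assouad_dim F\<close>, efficient covers must fail for every \<open>L\<close>: some ball of \<open>F\<close>
  has no cover of relative \<open>t\<close>-cost at most \<open>1\<close> by balls from its first \<open>L\<close> dyadic levels. A cheap
  finite cover of the limit microset by open balls would cover the late zooms as well, and rounding
  its radii to dyadic ones would give such a forbidden cover.
\<close>

lemma ex_gallery_hausdorff_dim_ge:
  fixes F :: "(real ^ 'n) set"
  assumes "compact F" and t: "0 < t" and "ereal t < assouad_dim F"
  shows "\<exists>E\<in>gallery F. ereal t \<le> hausdorff_dim E"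
proof -
  have "\<exists>x \<rho>. x \<in> F \<and> 0 < \<rho> \<and> \<rho> \<le> 1 / 4 \<and> (\<forall>P. finite P \<and> P \<subseteq> F \<times> {1..L} \<and>
      F \<inter> cball x \<rho> \<subseteq> (\<Union>(u, m)\<in>P. cball u (\<rho> / 2 ^ m)) \<longrightarrow>
      1 < (\<Sum>(u, m)\<in>P. 2 powr (- t * real m)))" for L :: nat
  proof (rule ccontr)
    assume "\<not> ?thesis"
    then have "assouad_dim F \<le> ereal t"
      by (intro assouad_dim_le_if_efficient_covers[OF assms(1) less_imp_le[OF t], of L])
        (metis not_less)
    then show False
      using assms(3) by simp
  qed
  then obtain x \<rho> where x: "\<And>L. x L \<in> F" and \<rho>: "\<And>L. 0 < \<rho> L" "\<And>L. \<rho> L \<le> 1 / 4"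
    and costly: "\<And>L P. finite P \<Longrightarrow> P \<subseteq> F \<times> {1..L} \<Longrightarrow>
      F \<inter> cball (x L) (\<rho> L) \<subseteq> (\<Union>(u, m)\<in>P. cball u (\<rho> L / 2 ^ m)) \<Longrightarrow>
      1 < (\<Sum>(u, m)\<in>P. 2 powr (- t * real m))"
    by metis
  \<comment> \<open>The costly ball becomes the ball of radius \<open>1 / 4\<close> about the centre, which lies in the cube.\<close>
  define c where "c L = 1 / (4 * \<rho> L)" for L
  have c: "1 \<le> c L" for L
    using \<rho>[of L] by (simp add: c_def)
  obtain E \<sigma> where \<sigma>: "strict_mono (\<sigma> :: nat \<Rightarrow> nat)" and gal: "E \<in> gallery F"
    and lim: "(\<lambda>k. hausdorff_distance (zoom F (x (\<sigma> k)) (c (\<sigma> k))) E) \<longlonglongrightarrow> 0"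
    by (rule zoom_limit[OF assms(1) x c])
  have E: "E \<noteq> {}" "compact E"
    using gal by (auto simp: gallery_def microset_def unit_cube_compacts_def)
  have "ereal t \<le> hausdorff_dim E"
  proof (rule hausdorff_dim_ge_if_finite_covers[OF E(2) t])
    show "0 < (1 / 16) powr t"
      by simp
    show "(1 / 16) powr t \<le> (\<Sum>(u, r)\<in>P. r powr t)"
      if P: "finite P" "P \<subseteq> E \<times> {0<..}" "E \<subseteq> (\<Union>(u, r)\<in>P. ball u r)" for P
    proof (rule ccontr)
      assume "\<not> ?thesis"
      then have cheap: "(\<Sum>(u, r)\<in>P. r powr t) < (1 / 16) powr t"
        by simp
      have r_small: "0 < snd p" "snd p < 1 / 16" if p: "p \<in> P" for p
      proof -
        show pos: "0 < snd p"
          using p P(2) by auto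
        have "snd p powr t \<le> (\<Sum>(u, r)\<in>P. r powr t)"
          using member_le_sum[OF p, of "\<lambda>(u, r). r powr t"] P(1) by (auto simp: case_prod_beta)
        then have "snd p powr t < (1 / 16) powr t"
          using cheap by simp
        then show "snd p < 1 / 16"
          using t powr_mono2[of t "1 / 16" "snd p"] by linarith
      qed
      have "\<exists>m. 1 \<le> m \<and> 2 ^ m \<le> 1 / (8 * snd p) \<and> 1 / (8 * snd p) < 2 ^ Suc m" if "p \<in> P" for p
      proof -
        obtain k where k: "k = 0 \<or> 2 ^ k \<le> 1 / (8 * snd p)" "1 / (8 * snd p) < 2 ^ Suc k"
          by (rule dyadic_bracket)
        moreover have "2 < 1 / (8 * snd p)"
          using r_small[OF that] by (simp add: field_simps)
        ultimately have "k \<noteq> 0"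
          by (intro notI) simp
        then show ?thesis
          using k by (intro exI[of _ k]) auto
      qed
      then obtain m where m: "\<And>p. p \<in> P \<Longrightarrow> 1 \<le> m p" "\<And>p. p \<in> P \<Longrightarrow> 2 ^ m p \<le> 1 / (8 * snd p)"
        "\<And>p. p \<in> P \<Longrightarrow> 1 / (8 * snd p) < 2 ^ Suc (m p)"
        by metis
      have "open (\<Union>(u, r)\<in>P. ball u r)"
        by auto
      then obtain \<epsilon> where \<epsilon>: "0 < \<epsilon>" "(\<Union>e\<in>E. ball e \<epsilon>) \<subseteq> (\<Union>(u, r)\<in>P. ball u r)"
        by (rule compact_subset_open_imp_ball_epsilon_subset[OF E(2) _ P(3)])
      define M where "M = Max (m ` P)"
      have "eventually (\<lambda>j. hausdorff_distance (zoom F (x (\<sigma> j)) (c (\<sigma> j))) E < \<epsilon> \<and> M \<le> j) sequentially"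
        by (intro eventually_conj order_tendstoD(2)[OF lim \<epsilon>(1)] eventually_ge_at_top)
      then obtain j where j: "hausdorff_distance (zoom F (x (\<sigma> j)) (c (\<sigma> j))) E < \<epsilon>" "M \<le> j"
        using eventually_happens'[OF sequentially_bot] by blast
      define L where "L = \<sigma> j"
      have mL: "m p \<le> L" if "p \<in> P" for p
      proof -
        have "m p \<le> M"
          using that P(1) by (simp add: M_def)
        then show ?thesis
          using j(2) seq_suble[OF \<sigma>, of j] by (simp add: L_def)
      qed
      define f where "f w = c L *\<^sub>R w + ((1 / 2) *\<^sub>R 1 - c L *\<^sub>R x L)" for w
      have c0: "0 < c L"
        using c[of L] by simp
      have f_dist: "dist (f v) (f w) = c L * dist v w" for v w
        unfolding f_def by (rule dist_similarity[OF c0])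
      have f_cover: "\<exists>p\<in>P. f w \<in> ball (fst p) (snd p)" if w: "w \<in> F \<inter> cball (x L) (\<rho> L)" for w
      proof -
        have "c L * dist (x L) w \<le> c L * \<rho> L"
          using w c0 by (intro mult_left_mono) auto
        also have "\<dots> = 1 / 4"
          using \<rho>(1)[of L] by (simp add: c_def)
        finally have "dist (f (x L)) (f w) \<le> 1 / 4"
          by (simp add: f_dist)
        then have "f w \<in> cbox 0 1"
          using centre_cball_subset_cube by (auto simp: f_def)
        then have "f w \<in> zoom F (x L) (c L)"
          using w by (auto simp: zoom_def f_def)
        moreover have "hausdorff_distance (zoom F (x L) (c L)) E < \<epsilon>"
          using j(1) by (simp add: L_def)
        ultimately obtain e where "e \<in> E" "dist (f w) e < \<epsilon>"
          using hausdorff_distance_lessE compact_imp_bounded[OF zoom_props(1)[OF assms(1) x c]] E(1)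
          by metis
        then have "f w \<in> (\<Union>e\<in>E. ball e \<epsilon>)"
          by (auto simp: dist_commute)
        with \<epsilon>(2) have "f w \<in> (\<Union>(u, r)\<in>P. ball u r)"
          by blast
        then show ?thesis
          by force
      qed
      define P' where "P' = {p \<in> P. \<exists>v\<in>F. f v \<in> ball (fst p) (snd p)}"
      have P': "finite P'" "P' \<subseteq> P"
        using P(1) by (auto simp: P'_def)
      have "\<forall>p\<in>P'. \<exists>v. v \<in> F \<and> f v \<in> ball (fst p) (snd p)"
        by (auto simp: P'_def)
      then obtain v where v: "\<And>p. p \<in> P' \<Longrightarrow> v p \<in> F" "\<And>p. p \<in> P' \<Longrightarrow> f (v p) \<in> ball (fst p) (snd p)"
        by metis
      let ?Q = "(\<lambda>p. (v p, m p)) ` P'"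
      have "F \<inter> cball (x L) (\<rho> L) \<subseteq> (\<Union>(u, m)\<in>?Q. cball u (\<rho> L / 2 ^ m))"
      proof
        fix w assume w: "w \<in> F \<inter> cball (x L) (\<rho> L)"
        then obtain p where p: "p \<in> P" "f w \<in> ball (fst p) (snd p)"
          using f_cover by blast
        then have p': "p \<in> P'"
          using w by (auto simp: P'_def)
        have "dist (f (v p)) (f w) < 2 * snd p"
          using p(2) v(2)[OF p'] dist_triangle2[of "f (v p)" "f w" "fst p"]
          by (simp add: dist_commute)
        also have "\<dots> \<le> c L * (\<rho> L / 2 ^ m p)"
          using m(2)[OF p(1)] r_small(1)[OF p(1)] \<rho>(1)[of L] by (simp add: c_def field_simps)
        finally have "dist (v p) w < \<rho> L / 2 ^ m p"
          by (simp only: f_dist mult_less_cancel_left_pos[OF c0])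
        then show "w \<in> (\<Union>(u, m)\<in>?Q. cball u (\<rho> L / 2 ^ m))"
          using p' by force
      qed
      moreover have "?Q \<subseteq> F \<times> {1..L}"
        using v(1) m(1) mL P'(2) by auto
      ultimately have "1 < (\<Sum>(u, m)\<in>?Q. 2 powr (- t * real m))"
        using P'(1) by (intro costly) auto
      also have "\<dots> \<le> (\<Sum>p\<in>P'. 2 powr (- t * real (m p)))"
        using sum_image_le[OF P'(1), of "\<lambda>(u, m). 2 powr (- t * real m)" "\<lambda>p. (v p, m p)"]
        by (simp add: o_def)
      also have "\<dots> \<le> (\<Sum>p\<in>P. 2 powr (- t * real (m p)))"
        using P(1) P'(2) by (intro sum_mono2) auto
      also have "\<dots> \<le> (\<Sum>p\<in>P. 16 powr t * snd p powr t)"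
      proof (rule sum_mono)
        fix p assume p: "p \<in> P"
        have "2 powr (- t * real (m p)) = (1 / 2 ^ m p) powr t"
          by (simp add: powr_divide powr_powr powr_minus_divide ac_simps flip: powr_realpow)
        also have "\<dots> \<le> (16 * snd p) powr t"
          using m(3)[OF p] r_small(1)[OF p] t by (intro powr_mono2) (auto simp: field_simps)
        finally show "2 powr (- t * real (m p)) \<le> 16 powr t * snd p powr t"
          using r_small(1)[OF p] by (simp add: powr_mult)
      qed
      also have "\<dots> = 16 powr t * (\<Sum>(u, r)\<in>P. r powr t)"
        by (simp add: sum_distrib_left case_prod_beta)
      also have "\<dots> < 16 powr t * (1 / 16) powr t"
        by (intro mult_strict_left_mono cheap) simp
      also have "\<dots> = 1"
        by (simp flip: powr_mult)
      finally show False
        by simp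
    qed
  qed
  then show ?thesis
    using gal by blast
qed

lemma lower_dim_nonneg:
  fixes F :: "(real ^ 'n) set"
  shows "0 \<le> lower_dim F"
proof -
  have "1 * (R / r) powr 0 \<le> real (covering_number r (cball x R \<inter> F))"
    if "x \<in> F" "0 < R" "R < 1" "0 < r" "r < R" for R r x
  proof -
    have "x \<in> cball x R \<inter> F"
      using that by simp
    then have "1 \<le> covering_number r (cball x R \<inter> F)"
      using \<open>0 < r\<close> by (intro covering_number_ge_1) (auto simp only: bounded_Int bounded_cball)
    then show ?thesis
      using that by simp
  qed
  then show ?thesis
    unfolding lower_dim_def zero_ereal_def by (intro Sup_upper) (auto intro!: exI[of _ 1])
qed

section \<open>The dichotomy\<close>

theorem corollary1p2:
  fixes F :: "(real ^ 'n) set"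
  assumes "compact F" and "F \<noteq> {}"
  shows "(\<forall>E1\<in>gallery F. \<forall>E2\<in>gallery F. hausdorff_dim E1 = hausdorff_dim E2) \<longleftrightarrow>
         lower_dim F = assouad_dim F"
proof -
  have bounds: "lower_dim F \<le> hausdorff_dim E" "hausdorff_dim E \<le> assouad_dim F" if "E \<in> gallery F" for E
    using lower_dim_le_hausdorff_dim_gallery[OF that] hausdorff_dim_microset_le_assouad_dim[OF assms(1)]
      that by (auto simp: gallery_def)
  show ?thesis
  proof
    assume const: "\<forall>E1\<in>gallery F. \<forall>E2\<in>gallery F. hausdorff_dim E1 = hausdorff_dim E2"
    show "lower_dim F = assouad_dim F"
    proof (rule ccontr)
      assume neq: "lower_dim F \<noteq> assouad_dim F"
      obtain x where "x \<in> F"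
        using assms(2) by blast
      then obtain E where "E \<in> gallery F"
        using zoom_limit[OF assms(1), of "\<lambda>_. x" "\<lambda>_. 1"] by (metis order_refl)
      then have "lower_dim F < assouad_dim F"
        using bounds neq by (metis order_trans less_le)
      then obtain s where s: "lower_dim F < ereal s" "ereal s < assouad_dim F"
        using ereal_dense2 by blast
      then obtain t where t: "ereal s < ereal t" "ereal t < assouad_dim F"
        using ereal_dense2 by blast
      have "0 \<le> s"
        using order_le_less_trans[OF lower_dim_nonneg s(1)] by simp
      then obtain E1 E2 where E1: "E1 \<in> gallery F" "hausdorff_dim E1 \<le> ereal s"
        and E2: "E2 \<in> gallery F" "ereal t \<le> hausdorff_dim E2"
        using ex_gallery_hausdorff_dim_le[OF assms(1) _ s(1)]
          ex_gallery_hausdorff_dim_ge[OF assms(1) _ t(2)] t(1) by auto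
      have "hausdorff_dim E2 = hausdorff_dim E1"
        using const E1(1) E2(1) by blast
      then have "ereal t \<le> ereal s"
        using E1(2) E2(2) by (metis order_trans)
      then show False
        using t(1) by simp
    qed
  next
    assume "lower_dim F = assouad_dim F"
    then show "\<forall>E1\<in>gallery F. \<forall>E2\<in>gallery F. hausdorff_dim E1 = hausdorff_dim E2"
      using bounds by (metis order_antisym)
  qed
qed

end
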